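(* Let $f:2^X\to\mathbb{R}_{\ge0}$ be monotone submodular and the constraint an arbitrary $p$-matchoid. Define $\gamma_1=4p$ and, for $i>1$, $\gamma_i=4p\,\frac{\gamma_{i-1}(\gamma_{i-1}-1)}{(\gamma_{i-1}-1+p)^2}$. Run MultipassLocalSearch$(\alpha,\beta_1,\dots,\beta_d)$ with $\alpha=0$, $\beta_1=1$ and $\beta_i=\frac{\gamma_{i-1}-1-p}{\gamma_{i-1}-1+p}$ for $i>1$, producing $S_1,\dots,S_d$. Then $\bigl(p+1+\tfrac{4p}{i}\bigr)f(S_i)\ge f(\mathit{OPT})$ for all $1\le i\le d$. In particular, after $i=4p/\varepsilon$ passes, $(p+1+\varepsilon)f(S_i)\ge f(\mathit{OPT})$.
   Context: $X$ is a finite ground set; $f:2^X\to\mathbb{R}_{\ge 0}$ is submodular and monotone. For $e\in X$, $A\subseteq X$ write $f(e\mid A)=f(A\cup\{e\})-f(A)$. A $p$-matchoid on $X$ is a collection of matroids $\mathcal{M}_\ell=(X_\ell,\mathcal{I}_\ell)$, $X_\ell\subseteq X$, such that every element of $X$ lies in at most $p$ of the sets $X_\ell$; $S\subseteq X$ is feasible ($S\in\mathcal{I}$) iff $S\cap X_\ell\in\mathcal{I}_\ell$ for all $\ell$. $\mathit{OPT}$ is a feasible set maximizing $f$. Elements of $X$ arrive one at a time in a stream; every pass receives all of $X$. Incremental values: given a total order $\prec$ on $X$, $\nu(e,T)=f(e\mid\{t\in T:t\prec e\})$. Exchange$(x,S)$: start with $C_x=\emptyset$; for each $\mathcal{M}_\ell$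 with $x\in X_\ell$, let $S_\ell=S\cap X_\ell$; if $S_\ell\cup\{x\}\notin\mathcal{I}_\ell$, let $T_\ell=\{y\in S_\ell:(S_\ell\setminus\{y\})\cup\{x\}\in\mathcal{I}_\ell\}$ and add to $C_x$ an element of $T_\ell$ minimizing $\nu(\cdot,S)$. Return $C_x$. StreamingLocalSearch$(\alpha,\beta,S_{\mathrm{init}})$: $S\leftarrow S_{\mathrm{init}}$; for each arriving $x$: if $x\in S_{\mathrm{init}}$ discard it; otherwise compute $C_x=$ Exchange$(x,S)$ and if $f(x\mid S)\ge\alpha+(1+\beta)\sum_{c\in C_x}\nu(c,S)$ set $S\leftarrow(S\setminus C_x)\cup\{x\}$, else reject $x$. Output the final $S$. The order $\prec$ for $\nu$ in a pass is the pretend order: elements of $S_{\mathrm{init}}$ first, in the same relative order as in the pretend order of the pass that produced $S_{\mathrm{init}}$, then elements of $X\setminus S_{\mathrm{init}}$ in arrival order. MultipassLocalSearch$(\alpha,\beta_1,\dots,\beta_d)$: $S_0=\emptyset$; for $i=1,\dots,d$, $S_i$ is the output of StreamingLocalSearch$(\alpha,\beta_i,S_{i-1})$ on a new pass. *)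

theory Defs
  imports Complex_Main
begin

section \<open>Submodular functions and \<open>p\<close>-matchoids\<close>

definition submodular_on :: "'a set \<Rightarrow> ('a set \<Rightarrow> real) \<Rightarrow> bool" where
  "submodular_on X f \<longleftrightarrow>
     (\<forall>A B. A \<subseteq> X \<longrightarrow> B \<subseteq> X \<longrightarrow> f (A \<union> B) + f (A \<inter> B) \<le> f A + f B)"

definition marginal :: "('a set \<Rightarrow> real) \<Rightarrow> 'a \<Rightarrow> 'a set \<Rightarrow> real" where
  "marginal f e A = f (A \<union> {e}) - f A"

definition matroid :: "'a set \<Rightarrow> 'a set set \<Rightarrow> bool" where
  "matroid E I \<longleftrightarrow>
     finite E \<and> I \<subseteq> Pow E \<and> {} \<in> I \<and>
     (\<forall>A\<in>I. \<forall>B. B \<subseteq> A \<longrightarrow> B \<in> I) \<and>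
     (\<forall>A\<in>I. \<forall>B\<in>I. card A < card B \<longrightarrow> (\<exists>x\<in>B - A. insert x A \<in> I))"

text \<open>The matroids of a matchoid form a family indexed by \<open>L\<close>, so the same matroid may occur
  repeatedly. The index set need not be finite; the explicit finiteness condition is needed
  because \<open>card\<close> is \<open>0\<close> on infinite sets.\<close>

definition matchoid :: "nat \<Rightarrow> 'a set \<Rightarrow> 'l set \<Rightarrow> ('l \<Rightarrow> 'a set) \<Rightarrow> ('l \<Rightarrow> 'a set set) \<Rightarrow> bool" where
  "matchoid p X L E I \<longleftrightarrow>
     (\<forall>l\<in>L. E l \<subseteq> X \<and> matroid (E l) (I l)) \<and>
     (\<forall>x\<in>X. finite {l\<in>L. x \<in> E l} \<and> card {l\<in>L. x \<in> E l} \<le> p)"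

definition feasible :: "'a set \<Rightarrow> 'l set \<Rightarrow> ('l \<Rightarrow> 'a set) \<Rightarrow> ('l \<Rightarrow> 'a set set) \<Rightarrow> 'a set \<Rightarrow> bool" where
  "feasible X L E I S \<longleftrightarrow> S \<subseteq> X \<and> (\<forall>l\<in>L. S \<inter> E l \<in> I l)"


section \<open>Streaming local search\<close>

text \<open>Total orders on \<open>X\<close> are given by duplicate-free lists enumerating \<open>X\<close>.\<close>

definition precedes :: "'a list \<Rightarrow> 'a \<Rightarrow> 'a \<Rightarrow> bool" where
  "precedes xs s t \<longleftrightarrow> (\<exists>i j. i < j \<and> j < length xs \<and> xs ! i = s \<and> xs ! j = t)"

definition incr_value :: "('a set \<Rightarrow> real) \<Rightarrow> 'a list \<Rightarrow> 'a \<Rightarrow> 'a set \<Rightarrow> real" where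
  "incr_value f ord e T = marginal f e {t\<in>T. precedes ord t e}"

text \<open>The matroids in which \<open>x\<close> conflicts with \<open>S\<close>, and the elements of \<open>S\<close> that can be
  exchanged for \<open>x\<close> in the matroid \<open>l\<close>.\<close>

definition conflicts :: "'l set \<Rightarrow> ('l \<Rightarrow> 'a set) \<Rightarrow> ('l \<Rightarrow> 'a set set) \<Rightarrow> 'a \<Rightarrow> 'a set \<Rightarrow> 'l set" where
  "conflicts L E I x S = {l\<in>L. x \<in> E l \<and> (S \<inter> E l) \<union> {x} \<notin> I l}"

definition swappable :: "('l \<Rightarrow> 'a set) \<Rightarrow> ('l \<Rightarrow> 'a set set) \<Rightarrow> 'a \<Rightarrow> 'a set \<Rightarrow> 'l \<Rightarrow> 'a set" where
  "swappable E I x S l = {y \<in> S \<inter> E l. ((S \<inter> E l) - {y}) \<union> {x} \<in> I l}"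

text \<open>\<open>exchange L E I \<nu> x S C\<close> means that \<open>C\<close> is a possible result of the exchange procedure;
  ties between minimizers may be broken arbitrarily, so this is a relation. There is no result
  iff some conflicting matroid has no swappable element (lemma \<open>exchange_ex\<close> below: for feasible
  \<open>S\<close>, this happens only if \<open>x\<close> is a loop of that matroid).\<close>

definition exchange ::
  "'l set \<Rightarrow> ('l \<Rightarrow> 'a set) \<Rightarrow> ('l \<Rightarrow> 'a set set) \<Rightarrow> ('a \<Rightarrow> 'a set \<Rightarrow> real) \<Rightarrow> 'a \<Rightarrow> 'a set \<Rightarrow> 'a set \<Rightarrow> bool"
where
  "exchange L E I \<nu> x S C \<longleftrightarrow>
     (\<exists>c. (\<forall>l\<in>conflicts L E I x S.
             is_arg_min (\<lambda>y. \<nu> y S) (\<lambda>y. y \<in> swappable E I x S l) (c l)) \<and>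
          C = c ` conflicts L E I x S)"

text \<open>One arrival: \<open>local_search_step f L E I \<nu> \<alpha> \<beta> S0 x S S'\<close> means that \<open>x\<close> arriving at the
  current solution \<open>S\<close> may lead to the solution \<open>S'\<close>, where \<open>S0\<close> is the initial solution of the
  pass. An element for which the exchange procedure has no result (a loop) is discarded.\<close>

inductive local_search_step ::
  "('a set \<Rightarrow> real) \<Rightarrow> 'l set \<Rightarrow> ('l \<Rightarrow> 'a set) \<Rightarrow> ('l \<Rightarrow> 'a set set) \<Rightarrow> ('a \<Rightarrow> 'a set \<Rightarrow> real) \<Rightarrow>
   real \<Rightarrow> real \<Rightarrow> 'a set \<Rightarrow> 'a \<Rightarrow> 'a set \<Rightarrow> 'a set \<Rightarrow> bool"
  for f L E I \<nu> \<alpha> \<beta> S0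
where
  discard: "x \<in> S0 \<Longrightarrow> local_search_step f L E I \<nu> \<alpha> \<beta> S0 x S S"
| accept: "x \<notin> S0 \<Longrightarrow> exchange L E I \<nu> x S C \<Longrightarrow>
    marginal f x S \<ge> \<alpha> + (1 + \<beta>) * (\<Sum>c\<in>C. \<nu> c S) \<Longrightarrow>
    local_search_step f L E I \<nu> \<alpha> \<beta> S0 x S ((S - C) \<union> {x})"
| reject: "x \<notin> S0 \<Longrightarrow> exchange L E I \<nu> x S C \<Longrightarrow>
    \<not> marginal f x S \<ge> \<alpha> + (1 + \<beta>) * (\<Sum>c\<in>C. \<nu> c S) \<Longrightarrow>
    local_search_step f L E I \<nu> \<alpha> \<beta> S0 x S S"
| loop: "x \<notin> S0 \<Longrightarrow> \<nexists>C. exchange L E I \<nu> x S C \<Longrightarrow>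
    local_search_step f L E I \<nu> \<alpha> \<beta> S0 x S S"

inductive local_search_run ::
  "('a set \<Rightarrow> real) \<Rightarrow> 'l set \<Rightarrow> ('l \<Rightarrow> 'a set) \<Rightarrow> ('l \<Rightarrow> 'a set set) \<Rightarrow> ('a \<Rightarrow> 'a set \<Rightarrow> real) \<Rightarrow>
   real \<Rightarrow> real \<Rightarrow> 'a set \<Rightarrow> 'a list \<Rightarrow> 'a set \<Rightarrow> 'a set \<Rightarrow> bool"
  for f L E I \<nu> \<alpha> \<beta> S0
where
  Nil: "local_search_run f L E I \<nu> \<alpha> \<beta> S0 [] S S"
| Cons: "local_search_step f L E I \<nu> \<alpha> \<beta> S0 x S S' \<Longrightarrow>
    local_search_run f L E I \<nu> \<alpha> \<beta> S0 xs S' S'' \<Longrightarrow>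
    local_search_run f L E I \<nu> \<alpha> \<beta> S0 (x # xs) S S''"

text \<open>A full pass over the stream \<open>xs\<close> with pretend order \<open>ord\<close>, initial solution \<open>S0\<close> and
  output \<open>S\<close>.\<close>

definition streaming_local_search ::
  "('a set \<Rightarrow> real) \<Rightarrow> 'l set \<Rightarrow> ('l \<Rightarrow> 'a set) \<Rightarrow> ('l \<Rightarrow> 'a set set) \<Rightarrow> 'a list \<Rightarrow>
   real \<Rightarrow> real \<Rightarrow> 'a list \<Rightarrow> 'a set \<Rightarrow> 'a set \<Rightarrow> bool"
where
  "streaming_local_search f L E I ord \<alpha> \<beta> xs S0 S \<longleftrightarrow>
     local_search_run f L E I (incr_value f ord) \<alpha> \<beta> S0 xs S0 S"


section \<open>Multipass local search\<close>

text \<open>\<open>stream i\<close> is the arrival order in pass \<open>i \<ge> 1\<close>, and \<open>S i\<close> the output of pass \<open>i\<close>.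
  \<open>pretend_order stream S i\<close> is the pretend order of pass \<open>i\<close>; with \<open>S 0 = {}\<close>, that of pass \<open>1\<close>
  is simply \<open>stream 1\<close>.\<close>

primrec pretend_order :: "(nat \<Rightarrow> 'a list) \<Rightarrow> (nat \<Rightarrow> 'a set) \<Rightarrow> nat \<Rightarrow> 'a list" where
  "pretend_order stream S 0 = []"
| "pretend_order stream S (Suc i) =
     filter (\<lambda>x. x \<in> S i) (pretend_order stream S i) @
     filter (\<lambda>x. x \<notin> S i) (stream (Suc i))"

definition multipass_local_search ::
  "('a set \<Rightarrow> real) \<Rightarrow> 'l set \<Rightarrow> ('l \<Rightarrow> 'a set) \<Rightarrow> ('l \<Rightarrow> 'a set set) \<Rightarrow>
   real \<Rightarrow> (nat \<Rightarrow> real) \<Rightarrow> nat \<Rightarrow> (nat \<Rightarrow> 'a list) \<Rightarrow> (nat \<Rightarrow> 'a set) \<Rightarrow> bool"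
where
  "multipass_local_search f L E I \<alpha> \<beta> d stream S \<longleftrightarrow>
     S 0 = {} \<and>
     (\<forall>i\<in>{1..d}. streaming_local_search f L E I (pretend_order stream S i) \<alpha> (\<beta> i)
                   (stream i) (S (i - 1)) (S i))"

text \<open>The sequences are indexed from \<open>1\<close>; the value at \<open>0\<close> is irrelevant.\<close>

fun gamma_seq :: "nat \<Rightarrow> nat \<Rightarrow> real" where
  "gamma_seq p 0 = 0"
| "gamma_seq p (Suc 0) = 4 * real p"
| "gamma_seq p (Suc (Suc i)) =
     4 * real p * (gamma_seq p (Suc i) * (gamma_seq p (Suc i) - 1)
                   / (gamma_seq p (Suc i) - 1 + real p)\<^sup>2)"

definition beta_seq :: "nat \<Rightarrow> nat \<Rightarrow> real" where
  "beta_seq p i =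
     (if i \<le> 1 then 1
      else (gamma_seq p (i - 1) - 1 - real p) / (gamma_seq p (i - 1) - 1 + real p))"


section \<open>When the exchange procedure has a result\<close>

lemma matroid_swap:
  assumes M: "matroid E I" and A: "A \<in> I" and x: "{x} \<in> I" and dep: "insert x A \<notin> I"
  shows "\<exists>y\<in>A. insert x (A - {y}) \<in> I"
proof -
  have fin: "finite B" if "B \<in> I" for B
    using M that unfolding matroid_def by (meson PowD finite_subset subsetD)
  have aug: "\<exists>z\<in>C - B. insert z B \<in> I" if "B \<in> I" "C \<in> I" "card B < card C" for B C
    using M that unfolding matroid_def by blast
  have xA: "x \<notin> A"
    using A dep by (auto simp: insert_absorb)
  have A0: "A \<noteq> {}"
    using x dep by auto
  have ex: "\<exists>B\<subseteq>A. insert x B \<in> I \<and> card B = k" if "k < card A" for k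
    using that
  proof (induction k)
    case 0
    then show ?case using x by auto
  next
    case (Suc k)
    then obtain B where B: "B \<subseteq> A" "insert x B \<in> I" "card B = k" by auto
    have fB: "finite B" using B(1) fin[OF A] finite_subset by blast
    have xB: "x \<notin> B" using B(1) xA by blast
    have "card (insert x B) < card A" using B(3) Suc.prems fB xB by simp
    then obtain z where z: "z \<in> A" "z \<notin> insert x B" "insert z (insert x B) \<in> I"
      using aug[OF B(2) A] by blast
    then have "insert z B \<subseteq> A" "insert x (insert z B) \<in> I" "card (insert z B) = Suc k"
      using B fB by (auto simp: insert_commute)
    then show ?case by blast
  qed
  have pos: "card A > 0" using A0 fin[OF A] by (simp add: card_gt_0_iff)
  then obtain B where B: "B \<subseteq> A" "insert x B \<in> I" "card B = card A - 1"
    using ex[of "card A - 1"] by auto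
  have "card (A - B) = 1"
    using B pos fin[OF A] by (simp add: card_Diff_subset finite_subset)
  then obtain y where "A - B = {y}" using card_1_singletonE by blast
  then have "y \<in> A" "A - {y} = B" using B(1) by auto
  then show ?thesis using B(2) by auto
qed

lemma exchange_ex:
  assumes M: "matchoid p X L E I" and S: "feasible X L E I S"
    and x: "\<And>l. l \<in> L \<Longrightarrow> x \<in> E l \<Longrightarrow> {x} \<in> I l"
  shows "\<exists>C. exchange L E I \<nu> x S C"
proof -
  have "\<exists>y. is_arg_min (\<lambda>y. \<nu> y S) (\<lambda>y. y \<in> swappable E I x S l) y"
    if l: "l \<in> conflicts L E I x S" for l
  proof -
    have lL: "l \<in> L" and xl: "x \<in> E l" and dep: "insert x (S \<inter> E l) \<notin> I l"
      using l by (auto simp: conflicts_def)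
    have m: "matroid (E l) (I l)" using M lL by (simp add: matchoid_def)
    have SI: "S \<inter> E l \<in> I l" using S lL by (simp add: feasible_def)
    have "swappable E I x S l \<noteq> {}"
      using matroid_swap[OF m SI x[OF lL xl] dep] by (auto simp: swappable_def)
    moreover have "finite (swappable E I x S l)"
      using m by (auto simp: swappable_def matroid_def intro: finite_subset[of _ "E l"])
    ultimately show ?thesis using ex_is_arg_min_if_finite by blast
  qed
  then have "\<exists>c. \<forall>l\<in>conflicts L E I x S.
      is_arg_min (\<lambda>y. \<nu> y S) (\<lambda>y. y \<in> swappable E I x S l) (c l)"
    by (intro bchoice) blast
  then show ?thesis unfolding exchange_def by blast
qed

end

theory Submission
  imports Defs
begin

text \<open>
  Let \<open>u\<close> and \<open>v\<close> be the values of the solution before and after a pass, and let \<open>D\<close> be the sum of the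
  incremental values, at the moment of removal, of the elements removed during the pass. Every exchange
  gains at least \<open>\<beta>\<close> times what it removes, so \<open>\<beta> D \<le> v - u\<close>, and adding the removed elements back to
  the final solution raises \<open>f\<close> by at most \<open>D\<close>.

  The rejected elements of \<open>OPT\<close> are charged to solution and removed elements separately in each
  matroid. For every threshold \<open>\<theta> > 0\<close>, the rejected elements whose cheapest swap had value at least
  \<open>\<theta>\<close> are spanned by the chargeable elements of value at least \<open>\<theta>\<close>; this survives an exchange
  because a cheapest swappable element is spanned by the rest of its circuit. As \<open>OPT\<close> is independent,
  comparing cardinalities for all \<open>\<theta>\<close> bounds the sums. A removed element is not charged in the matroid
  that caused its removal, so it is charged at most \<open>p - 1\<close> times. Hence
  \<open>f OPT \<le> v + D + (1 + \<beta>) (p v + (p - 1) D)\<close>. Eliminating \<open>D\<close> and using \<open>f OPT \<le> \<gamma> u\<close> gives the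
  recursion for \<open>\<gamma>\<close>.
\<close>

section \<open>Span in a matroid\<close>

text \<open>Matroid closure without reference to a ground set: the witness \<open>J\<close> may be
  empty, so loops and elements outside the ground set lie in every span. The disjunct
  \<open>e \<in> J\<close> takes care of the non-loops in \<open>B\<close>.\<close>

definition span_in :: "'a set set \<Rightarrow> 'a set \<Rightarrow> 'a set" where
  "span_in I B = {e. \<exists>J\<subseteq>B. J \<in> I \<and> (e \<in> J \<or> insert e J \<notin> I)}"

definition basis_in :: "'a set set \<Rightarrow> 'a set \<Rightarrow> 'a set \<Rightarrow> bool" where
  "basis_in I B J \<longleftrightarrow> J \<subseteq> B \<and> J \<in> I \<and> (\<forall>e\<in>B - J. insert e J \<notin> I)"

lemma span_in_mono: "A \<subseteq> B \<Longrightarrow> span_in I A \<subseteq> span_in I B"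
  unfolding span_in_def by blast

context
  fixes E :: "'a set" and I :: "'a set set"
  assumes matroid: "matroid E I"
begin

lemma indep_finite: "A \<in> I \<Longrightarrow> finite A"
  using matroid unfolding matroid_def by (meson PowD finite_subset subsetD)

lemma indep_subset: "A \<in> I \<Longrightarrow> B \<subseteq> A \<Longrightarrow> B \<in> I"
  using matroid unfolding matroid_def by blast

lemma indep_augment: "A \<in> I \<Longrightarrow> B \<in> I \<Longrightarrow> card A < card B \<Longrightarrow> \<exists>x\<in>B - A. insert x A \<in> I"
  using matroid unfolding matroid_def by blast

lemma span_in_superset: "B \<subseteq> span_in I B"
proof
  fix e assume e: "e \<in> B"
  have "{} \<in> I" using matroid unfolding matroid_def by blast
  then show "e \<in> span_in I B"
    using e unfolding span_in_def by (cases "{e} \<in> I") auto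
qed

lemma basis_extend:
  assumes "J \<in> I" "J \<subseteq> B"
  obtains K where "basis_in I B K" "J \<subseteq> K"
proof -
  have "finite E" using matroid unfolding matroid_def by blast
  have sub: "K \<subseteq> E" if "K \<in> I" for K using matroid that unfolding matroid_def by blast
  let ?P = "\<lambda>K. K \<in> I \<and> J \<subseteq> K \<and> K \<subseteq> B"
  have "\<exists>K. ?P K \<and> (\<forall>K'. ?P K' \<longrightarrow> card K' \<le> card K)"
    by (rule ex_has_greatest_nat[of ?P J card "Suc (card E)"])
      (use assms sub \<open>finite E\<close> in \<open>auto simp: card_mono less_Suc_eq_le\<close>)
  then obtain K where K: "?P K" "\<And>K'. ?P K' \<Longrightarrow> card K' \<le> card K" by blast
  have "insert e K \<notin> I" if "e \<in> B - K" for e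
  proof
    assume "insert e K \<in> I"
    then have "card (insert e K) \<le> card K" using K that by blast
    then show False using indep_finite K(1) that by simp
  qed
  then show ?thesis using K that[of K] unfolding basis_in_def by blast
qed

lemma basis_ex: obtains K where "basis_in I B K"
proof -
  have "{} \<in> I" using matroid unfolding matroid_def by blast
  then show ?thesis by (rule basis_extend[where B = B]) (use that in auto)
qed

lemma basis_card_le:
  assumes "basis_in I B J" "K \<in> I" "K \<subseteq> B"
  shows "card K \<le> card J"
proof (rule ccontr)
  assume "\<not> ?thesis"
  then obtain x where "x \<in> K - J" "insert x J \<in> I"
    using indep_augment[of J K] assms unfolding basis_in_def by force
  then show False using assms unfolding basis_in_def by blast
qed

text \<open>Any single basis decides the span. Otherwise \<open>insert e J\<close> is independent
  and larger than a basis \<open>K\<close> extending the witness \<open>J1\<close> for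
  \<open>e\<close>. Augmenting \<open>K\<close> from it cannot add \<open>e\<close>, since
  \<open>insert e J1\<close> is dependent, nor an element of \<open>J\<close>, since
  \<open>K\<close> is maximal in \<open>B\<close>.\<close>

lemma basis_spans:
  assumes J: "basis_in I B J" and e: "e \<in> span_in I B"
  shows "e \<in> J \<or> insert e J \<notin> I"
proof (rule ccontr)
  assume neg: "\<not> ?thesis"
  obtain J1 where J1: "J1 \<subseteq> B" "J1 \<in> I" "e \<in> J1 \<or> insert e J1 \<notin> I"
    using e unfolding span_in_def by blast
  then obtain K where K: "basis_in I B K" "J1 \<subseteq> K"
    using basis_extend by blast
  have eB: "e \<notin> B" using J neg unfolding basis_in_def by blast
  then have eK: "insert e K \<notin> I"
    using J1 K indep_subset[of "insert e K" "insert e J1"] by blast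
  have "card K \<le> card J" using basis_card_le[OF J] K unfolding basis_in_def by blast
  also have "\<dots> < card (insert e J)" using neg J indep_finite unfolding basis_in_def by simp
  finally obtain x where "x \<in> insert e J - K" "insert x K \<in> I"
    using indep_augment[of K "insert e J"] K neg unfolding basis_in_def by blast
  then show False using eK K J unfolding basis_in_def by blast
qed

text \<open>A basis of \<open>B\<close> is still a basis of \<open>A \<union> B\<close>, because it
  spans every element of \<open>A\<close>.\<close>

lemma span_in_trans:
  assumes "A \<subseteq> span_in I B"
  shows "span_in I A \<subseteq> span_in I B"
proof
  fix e assume e: "e \<in> span_in I A"
  obtain J where J: "basis_in I B J" by (rule basis_ex)
  have "basis_in I (A \<union> B) J"
    using J assms basis_spans[OF J] unfolding basis_in_def by blast
  moreover have "e \<in> span_in I (A \<union> B)"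
    using e span_in_mono[of A "A \<union> B" I] by blast
  ultimately have "e \<in> J \<or> insert e J \<notin> I" by (rule basis_spans)
  then show "e \<in> span_in I B" using J unfolding span_in_def basis_in_def by blast
qed

text \<open>If \<open>Z\<close> were larger than a basis \<open>J\<close> of \<open>B\<close>,
  augmentation would add to \<open>J\<close> an element that \<open>J\<close> already spans.\<close>

lemma indep_card_le_span:
  assumes Z: "Z \<in> I" "Z \<subseteq> span_in I B" and B: "finite B"
  shows "card Z \<le> card B"
proof -
  obtain J where J: "basis_in I B J" by (rule basis_ex)
  have "card Z \<le> card J"
  proof (rule ccontr)
    assume "\<not> ?thesis"
    then obtain x where "x \<in> Z - J" "insert x J \<in> I"
      using indep_augment[of J Z] Z J unfolding basis_in_def by force
    then show False using Z basis_spans[OF J] by blast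
  qed
  also have "card J \<le> card B" using J B unfolding basis_in_def by (simp add: card_mono)
  finally show ?thesis .
qed

text \<open>\<open>insert x T\<close> is the fundamental circuit of \<open>x\<close> over
  \<open>J\<close>. Were it independent, it would extend to a basis \<open>K\<close> of
  \<open>insert x J\<close> missing exactly one \<open>y \<in> J\<close>; then \<open>y\<close> is
  swappable, although \<open>T\<close> lies inside \<open>K\<close>.\<close>

lemma swappable_dependent:
  assumes J: "J \<in> I" and dep: "insert x J \<notin> I"
    and T: "T = {y \<in> J. insert x (J - {y}) \<in> I}"
  shows "insert x T \<notin> I"
proof
  assume xT: "insert x T \<in> I"
  have xJ: "x \<notin> J" using J dep by (auto simp: insert_absorb)
  obtain K where K: "basis_in I (insert x J) K" "insert x T \<subseteq> K"
    using basis_extend[OF xT, of "insert x J"] T by blast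
  have KI: "K \<in> I" "K \<subseteq> insert x J" using K unfolding basis_in_def by auto
  have fin: "finite J" "finite K" using J KI indep_finite by auto
  \<comment> \<open>\<open>K\<close> has at least \<open>card J\<close> elements, one of them
    \<open>x\<close>, so it omits at most one element of \<open>J\<close>. Omitting none would make
    \<open>insert x J\<close> independent.\<close>
  have "card J \<le> card K" using basis_card_le[OF K(1) J] by blast
  moreover have "card K = Suc (card (K - {x}))"
    by (rule card_Suc_Diff1[symmetric]) (use K(2) fin in auto)
  moreover have "K - {x} \<subseteq> J" using KI by blast
  ultimately have "card (J - (K - {x})) \<le> 1" using fin by (simp add: card_Diff_subset)
  moreover have "\<not> J \<subseteq> K" using indep_subset[OF KI(1), of "insert x J"] K(2) dep by blast
  then have "J - (K - {x}) \<noteq> {}" by blast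
  then have "card (J - (K - {x})) > 0" using fin by (simp add: card_gt_0_iff)
  ultimately have "card (J - (K - {x})) = 1" by linarith
  then obtain y where y: "J - (K - {x}) = {y}" using card_1_singletonE by blast
  then have "insert x (J - {y}) = K" using KI K xJ by blast
  then have "y \<in> T" using T KI y by blast
  then show False using K y xJ T by blast
qed

text \<open>Every element of a circuit is spanned by the others. The witness for \<open>x\<close> is
  \<open>T\<close>; the one for \<open>y\<close> is \<open>insert x (T - {y})\<close>, independent
  because \<open>y\<close> is swappable.\<close>

lemma swappable_span:
  assumes J: "J \<in> I" and dep: "insert x J \<notin> I"
    and T: "T = {y \<in> J. insert x (J - {y}) \<in> I}"
  shows "x \<in> span_in I T" and "y \<in> T \<Longrightarrow> y \<in> span_in I (insert x (T - {y}))"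
proof -
  have *: "insert x T \<notin> I" using swappable_dependent[OF J dep T] .
  then show "x \<in> span_in I T"
    using T J indep_subset[of J T] unfolding span_in_def by blast
  assume y: "y \<in> T"
  then have "insert x (T - {y}) \<in> I"
    using T indep_subset[of "insert x (J - {y})" "insert x (T - {y})"] by blast
  moreover have "insert y (insert x (T - {y})) = insert x T" using y by blast
  ultimately have "\<exists>J\<subseteq>insert x (T - {y}). J \<in> I \<and> (y \<in> J \<or> insert y J \<notin> I)"
    using * by (intro exI[of _ "insert x (T - {y})"]) simp
  then show "y \<in> span_in I (insert x (T - {y}))"
    by (simp add: span_in_def)
qed

end

text \<open>A finite layer-cake argument. A heaviest \<open>q\<close> is matched with some
  \<open>k\<close> of at least its value. Deleting both preserves the cardinality condition: up to
  the threshold \<open>w q\<close> both counts drop by one, and above it no element of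
  \<open>Q\<close> is left.\<close>

lemma sum_le_if_thresholds:
  fixes w :: "'a \<Rightarrow> real" and v :: "'b \<Rightarrow> real"
  assumes "finite Q" "finite K"
    and nonneg: "\<And>k. k \<in> K \<Longrightarrow> 0 \<le> v k"
    and card: "\<And>\<theta>. 0 < \<theta> \<Longrightarrow> card {q\<in>Q. \<theta> \<le> w q} \<le> card {k\<in>K. \<theta> \<le> v k}"
  shows "sum w Q \<le> sum v K"
  using assms
proof (induction Q arbitrary: K rule: finite_ranking_induct[where f = w])
  case empty
  then show ?case by (simp add: sum_nonneg)
next
  case (insert q Q)
  note fin = \<open>finite Q\<close> \<open>finite K\<close>
  \<comment> \<open>The ranking induction only guarantees that \<open>q\<close> is heaviest, not
    that it is new. If \<open>w q \<le> 0\<close>, all weights are nonpositive.\<close>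
  consider "q \<in> Q" | "q \<notin> Q" "w q \<le> 0" | "q \<notin> Q" "0 < w q" by linarith
  then show ?case
  proof cases
    case 1
    then show ?thesis using insert by (simp add: insert_absorb)
  next
    case 2
    then have "sum w (insert q Q) \<le> 0"
      using insert.hyps by (intro sum_nonpos) (auto intro: order_trans)
    also have "0 \<le> sum v K" using insert.prems by (simp add: sum_nonneg)
    finally show ?thesis .
  next
    case 3
    have "0 < card {r \<in> insert q Q. w q \<le> w r}" using fin by (auto simp: card_gt_0_iff)
    also have "\<dots> \<le> card {k \<in> K. w q \<le> v k}" using insert.prems 3 by blast
    finally obtain k where k: "k \<in> K" "w q \<le> v k" by (auto simp: card_gt_0_iff)
    have "sum w Q \<le> sum v (K - {k})"
    proof (rule insert.IH)
      fix \<theta> :: real assume \<theta>: "0 < \<theta>"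
      show "card {r \<in> Q. \<theta> \<le> w r} \<le> card {j \<in> K - {k}. \<theta> \<le> v j}"
      proof (cases "\<theta> \<le> w q")
        case True
        have "{r \<in> insert q Q. \<theta> \<le> w r} = insert q {r \<in> Q. \<theta> \<le> w r}" using True by blast
        then have 1: "card {r \<in> insert q Q. \<theta> \<le> w r} = Suc (card {r \<in> Q. \<theta> \<le> w r})"
          using fin 3 by simp
        have "{j \<in> K. \<theta> \<le> v j} = insert k {j \<in> K - {k}. \<theta> \<le> v j}" using True k by auto
        then have "card {j \<in> K. \<theta> \<le> v j} = card (insert k {j \<in> K - {k}. \<theta> \<le> v j})"
          by simp
        also have "\<dots> = Suc (card {j \<in> K - {k}. \<theta> \<le> v j})" using fin by simp
        finally show ?thesis using 1 insert.prems(3)[OF \<theta>] by linarith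
      next
        case False
        then have "{r \<in> Q. \<theta> \<le> w r} = {}" using insert.hyps(2) by force
        then show ?thesis by (metis card.empty le0)
      qed
    qed (use insert.prems in auto)
    then show ?thesis using 3 fin k by (simp add: sum.remove[of K k v])
  qed
qed


section \<open>Incremental values\<close>

lemma precedes_nth_iff:
  assumes "distinct ord" "i < length ord" "j < length ord"
  shows "precedes ord (ord ! i) (ord ! j) \<longleftrightarrow> i < j"
  using assms by (auto simp: precedes_def nth_eq_iff_index_eq)

text \<open>Replaces the list order by a comparison of positions, so that
  \<open>finite_ranking_induct\<close> can add elements along the order.\<close>

lemma precedes_ranking:
  assumes "distinct ord"
  obtains r :: "'a \<Rightarrow> nat"
  where "inj_on r (set ord)"
    and "\<And>s t. s \<in> set ord \<Longrightarrow> t \<in> set ord \<Longrightarrow> precedes ord s t \<longleftrightarrow> r s < r t"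
proof -
  let ?r = "the_inv_into {..<length ord} ((!) ord)"
  have "inj_on ((!) ord) {..<length ord}"
    using assms by (auto simp: inj_on_def nth_eq_iff_index_eq)
  then have inv: "?r (ord ! i) = i" if "i < length ord" for i
    using that by (auto intro: the_inv_into_f_f)
  show ?thesis
  proof (rule that)
    show "inj_on ?r (set ord)"
      by (rule inj_onI) (metis inv in_set_conv_nth)
  next
    fix s t assume "s \<in> set ord" "t \<in> set ord"
    then obtain i j where "s = ord ! i" "t = ord ! j" "i < length ord" "j < length ord"
      by (auto simp: in_set_conv_nth)
    then show "precedes ord s t \<longleftrightarrow> ?r s < ?r t"
      using assms by (simp add: precedes_nth_iff inv)
  qed
qed

lemma precedes_append:
  assumes d: "distinct (us @ x # vs)" and t: "t \<in> set us"
  shows "precedes (us @ x # vs) t x" "\<not> precedes (us @ x # vs) x t"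
proof -
  obtain i where i: "i < length us" "us ! i = t" using t by (auto simp: in_set_conv_nth)
  show "precedes (us @ x # vs) t x"
    using precedes_nth_iff[OF d, of i "length us"] i by (simp add: nth_append)
  show "\<not> precedes (us @ x # vs) x t"
    using precedes_nth_iff[OF d, of "length us" i] i by (simp add: nth_append)
qed

section \<open>Marginals and incremental values of a monotone submodular function\<close>

locale monotone_submodular =
  fixes X :: "'a set" and f :: "'a set \<Rightarrow> real"
  assumes finite_ground: "finite X"
    and nonneg: "A \<subseteq> X \<Longrightarrow> 0 \<le> f A"
    and submodular: "submodular_on X f"
    and mono: "mono_on (Pow X) f"
begin

lemma f_mono: "A \<subseteq> B \<Longrightarrow> B \<subseteq> X \<Longrightarrow> f A \<le> f B"
  using mono by (auto simp: mono_on_def)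

lemma marginal_nonneg: "A \<subseteq> X \<Longrightarrow> e \<in> X \<Longrightarrow> 0 \<le> marginal f e A"
  unfolding marginal_def using f_mono[of A "A \<union> {e}"] by auto

text \<open>For \<open>e\<close> outside \<open>B\<close> this is submodularity for
  \<open>A \<union> {e}\<close> and \<open>B\<close>; for \<open>e \<in> B\<close> the left side
  vanishes and monotonicity suffices.\<close>

lemma marginal_antimono:
  assumes "A \<subseteq> B" "B \<subseteq> X" "e \<in> X"
  shows "marginal f e B \<le> marginal f e A"
proof (cases "e \<in> B")
  case True
  then have "marginal f e B = 0" by (simp add: marginal_def insert_absorb)
  moreover have "0 \<le> marginal f e A"
    by (rule marginal_nonneg) (use assms in auto)
  ultimately show ?thesis by linarith
next
  case False
  have "f ((A \<union> {e}) \<union> B) + f ((A \<union> {e}) \<inter> B) \<le> f (A \<union> {e}) + f B"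
    by (rule submodular[unfolded submodular_on_def, rule_format]) (use assms in auto)
  moreover have "(A \<union> {e}) \<union> B = B \<union> {e}" "(A \<union> {e}) \<inter> B = A"
    using assms False by auto
  ultimately show ?thesis unfolding marginal_def by (simp only:)
qed

lemma union_le_sum_marginal:
  assumes "finite B" "A \<subseteq> X" "B \<subseteq> X"
  shows "f (A \<union> B) \<le> f A + (\<Sum>b\<in>B. marginal f b A)"
  using assms
proof (induction B rule: finite_induct)
  case (insert b B)
  have "f (A \<union> insert b B) = f (A \<union> B) + marginal f b (A \<union> B)"
    by (simp add: marginal_def)
  moreover have "marginal f b (A \<union> B) \<le> marginal f b A"
    by (rule marginal_antimono) (use insert.prems in auto)
  moreover have "f (A \<union> B) \<le> f A + (\<Sum>b\<in>B. marginal f b A)"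
    by (rule insert.IH) (use insert.prems in auto)
  ultimately have "f (A \<union> insert b B) \<le> f A + (\<Sum>b\<in>B. marginal f b A) + marginal f b A"
    by linarith
  also have "\<dots> = f A + (\<Sum>b\<in>insert b B. marginal f b A)"
    using insert.hyps by simp
  finally show ?case .
qed simp

lemma incr_value_nonneg: "T \<subseteq> X \<Longrightarrow> e \<in> X \<Longrightarrow> 0 \<le> incr_value f ord e T"
  unfolding incr_value_def by (rule marginal_nonneg) auto

text \<open>Telescoping along the order: the last element contributes exactly its marginal over all
  others and does not enter their values.\<close>

lemma sum_incr_value:
  assumes "distinct ord" "set ord = X" "S \<subseteq> X"
  shows "(\<Sum>t\<in>S. incr_value f ord t S) = f S - f {}"
proof -
  obtain r :: "'a \<Rightarrow> nat" where inj: "inj_on r X" and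
    r: "\<And>s t. s \<in> X \<Longrightarrow> t \<in> X \<Longrightarrow> precedes ord s t \<longleftrightarrow> r s < r t"
    by (rule precedes_ranking[OF assms(1), unfolded assms(2)]) blast
  have "finite S" using assms(3) finite_ground by (rule finite_subset)
  then show ?thesis using assms(3)
  proof (induction S rule: finite_ranking_induct[where f = r])
    case (insert x S)
    show ?case
    proof (cases "x \<in> S")
      case True
      then have "insert x S = S" by blast
      then show ?thesis using insert.IH insert.prems by simp
    next
      case False
      have "{s \<in> insert x S. precedes ord s t} = {s \<in> S. precedes ord s t}" if "t \<in> S" for t
        using r[of x t] insert.prems insert.hyps(2)[OF that] that by auto
      then have "(\<Sum>t\<in>S. incr_value f ord t (insert x S)) = (\<Sum>t\<in>S. incr_value f ord t S)"
        by (simp add: incr_value_def)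
      moreover have "precedes ord s x" if "s \<in> S" for s
      proof -
        have "r s \<noteq> r x" using inj that False insert.prems by (auto dest: inj_onD)
        then have "r s < r x" using insert.hyps(2)[OF that] by linarith
        then show ?thesis using r[of s x] that insert.prems by blast
      qed
      then have "{s \<in> insert x S. precedes ord s x} = S"
        using r[of x x] insert.prems by auto
      then have "incr_value f ord x (insert x S) = f (insert x S) - f S"
        by (simp add: incr_value_def marginal_def)
      ultimately show ?thesis using insert.IH insert.prems insert.hyps(1) False by simp
    qed
  qed simp
qed

text \<open>The latest element of \<open>C\<close> is removed first, which leaves the values of the
  rest of \<open>C\<close> unchanged. Its loss is its marginal over all other elements, at most its
  marginal over its predecessors.\<close>

lemma remove_le_sum_incr_value:
  assumes "distinct ord" "set ord = X" "S \<subseteq> X" "C \<subseteq> S"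
  shows "f S - f (S - C) \<le> (\<Sum>c\<in>C. incr_value f ord c S)"
proof -
  obtain r :: "'a \<Rightarrow> nat" where inj: "inj_on r X" and
    r: "\<And>s t. s \<in> X \<Longrightarrow> t \<in> X \<Longrightarrow> precedes ord s t \<longleftrightarrow> r s < r t"
    by (rule precedes_ranking[OF assms(1), unfolded assms(2)]) blast
  have "finite C"
    by (rule finite_subset[OF _ finite_ground]) (use assms(3,4) in blast)
  then show ?thesis using assms(3,4)
  proof (induction C arbitrary: S rule: finite_ranking_induct[where f = r])
    case (insert x C)
    show ?case
    proof (cases "x \<in> C")
      case True
      then have "insert x C = C" by blast
      then show ?thesis using insert.IH[of S] insert.prems by simp
    next
      case False
      have "{s \<in> S - {x}. precedes ord s c} = {s \<in> S. precedes ord s c}" if "c \<in> C" for c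
        using r[of x c] insert.prems insert.hyps(2)[OF that] that by auto
      then have 1: "(\<Sum>c\<in>C. incr_value f ord c (S - {x})) = (\<Sum>c\<in>C. incr_value f ord c S)"
        by (simp add: incr_value_def)
      have "C \<subseteq> S - {x}" using insert.prems False by blast
      then have 2: "f (S - {x}) - f (S - {x} - C) \<le> (\<Sum>c\<in>C. incr_value f ord c (S - {x}))"
        by (intro insert.IH) (use insert.prems in auto)
      have "S - {x} \<union> {x} = S" using insert.prems by blast
      then have "f S - f (S - {x}) = marginal f x (S - {x})"
        unfolding marginal_def by (rule arg_cong[where f = "\<lambda>A. f A - f (S - {x})", symmetric])
      also have "\<dots> \<le> incr_value f ord x S"
        unfolding incr_value_def
        by (rule marginal_antimono) (use insert.prems r[of x x] in auto)
      finally have 3: "f S - f (S - {x}) \<le> incr_value f ord x S" .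
      have 4: "S - {x} - C = S - insert x C" by blast
      have "(\<Sum>c\<in>insert x C. incr_value f ord c S)
          = incr_value f ord x S + (\<Sum>c\<in>C. incr_value f ord c S)"
        using insert.hyps(1) False by simp
      then show ?thesis using 1 2 3 unfolding 4 by linarith
    qed
  qed simp
qed

end

section \<open>A single pass\<close>

locale local_search_pass = monotone_submodular X f
  for X :: "'a set" and f +
  fixes p :: nat and L :: "'l set" and E :: "'l \<Rightarrow> 'a set" and I :: "'l \<Rightarrow> 'a set set"
    and ord :: "'a list" and \<beta> :: real and S0 OPT :: "'a set"
  assumes matchoid: "matchoid p X L E I"
    and feasible_OPT: "feasible X L E I OPT"
    and distinct_ord: "distinct ord"
    and set_ord: "set ord = X"
    and beta_nonneg: "0 \<le> \<beta>"
begin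

abbreviation \<nu> :: "'a \<Rightarrow> 'a set \<Rightarrow> real" where "\<nu> \<equiv> incr_value f ord"

section \<open>Results of an exchange\<close>

lemma matroid_E: "l \<in> L \<Longrightarrow> matroid (E l) (I l)"
  using matchoid by (simp add: matchoid_def)

lemma finite_matroids_at: "x \<in> X \<Longrightarrow> finite {l\<in>L. x \<in> E l}"
  and card_matroids_at: "x \<in> X \<Longrightarrow> card {l\<in>L. x \<in> E l} \<le> p"
  using matchoid by (simp_all add: matchoid_def)

text \<open>Joins the minimality of the chosen elements with the circuit formed, in each conflicting
  matroid, by \<open>x\<close> and the swappable elements.\<close>

lemma exchangeE:
  assumes ex: "exchange L E I \<nu> x S C" and S: "feasible X L E I S" and x: "x \<in> X"
  obtains c where "C = c ` conflicts L E I x S" "finite (conflicts L E I x S)"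
    "\<And>l. l \<in> conflicts L E I x S \<Longrightarrow> c l \<in> swappable E I x S l"
    "\<And>l y. l \<in> conflicts L E I x S \<Longrightarrow> y \<in> swappable E I x S l \<Longrightarrow> \<nu> (c l) S \<le> \<nu> y S"
    "\<And>l. l \<in> conflicts L E I x S \<Longrightarrow> x \<in> span_in (I l) (swappable E I x S l)"
    "\<And>l. l \<in> conflicts L E I x S \<Longrightarrow>
       c l \<in> span_in (I l) (insert x (swappable E I x S l - {c l}))"
proof -
  obtain c where c: "C = c ` conflicts L E I x S"
    "\<And>l. l \<in> conflicts L E I x S \<Longrightarrow>
       is_arg_min (\<lambda>y. \<nu> y S) (\<lambda>y. y \<in> swappable E I x S l) (c l)"
    using ex unfolding exchange_def by blast
  have fin: "finite (conflicts L E I x S)"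
    by (rule finite_subset[OF _ finite_matroids_at[OF x]]) (auto simp: conflicts_def)
  have sw: "c l \<in> swappable E I x S l" if "l \<in> conflicts L E I x S" for l
    using c(2)[OF that] by (simp add: is_arg_min_def)
  have span: "x \<in> span_in (I l) (swappable E I x S l)"
    "c l \<in> span_in (I l) (insert x (swappable E I x S l - {c l}))"
    if l: "l \<in> conflicts L E I x S" for l
  proof -
    have lL: "l \<in> L" and dep: "insert x (S \<inter> E l) \<notin> I l" using l by (auto simp: conflicts_def)
    have J: "S \<inter> E l \<in> I l" using S lL by (simp add: feasible_def)
    have T: "swappable E I x S l = {y \<in> S \<inter> E l. insert x (S \<inter> E l - {y}) \<in> I l}"
      by (simp add: swappable_def)
    show "x \<in> span_in (I l) (swappable E I x S l)"
      by (rule swappable_span(1)[OF matroid_E[OF lL] J dep T])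
    show "c l \<in> span_in (I l) (insert x (swappable E I x S l - {c l}))"
      by (rule swappable_span(2)[OF matroid_E[OF lL] J dep T sw[OF l]])
  qed
  show ?thesis
  proof (rule that[OF c(1) fin sw])
    fix l y assume "l \<in> conflicts L E I x S" "y \<in> swappable E I x S l"
    then show "\<nu> (c l) S \<le> \<nu> y S"
      using c(2)[of l] by (force simp: is_arg_min_def not_less)
  qed (use span in auto)
qed

text \<open>In a conflicting matroid the removal of \<open>c l\<close> alone restores independence;
  the removals due to other matroids only shrink the set.\<close>

lemma feasible_exchange:
  assumes ex: "exchange L E I \<nu> x S C" and S: "feasible X L E I S" and x: "x \<in> X"
  shows "feasible X L E I ((S - C) \<union> {x})"
proof -
  obtain c where c: "C = c ` conflicts L E I x S"
    "\<And>l. l \<in> conflicts L E I x S \<Longrightarrow> c l \<in> swappable E I x S l"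
    using exchangeE[OF ex S x] by metis
  have "((S - C) \<union> {x}) \<inter> E l \<in> I l" if l: "l \<in> L" for l
  proof -
    note sub = indep_subset[OF matroid_E[OF l]]
    show ?thesis
    proof (cases "l \<in> conflicts L E I x S")
      case True
      then have "(S \<inter> E l - {c l}) \<union> {x} \<in> I l" using c(2)[OF True] by (simp add: swappable_def)
      moreover have "c l \<in> C" using c(1) True by blast
      ultimately show ?thesis by (elim sub) blast
    next
      case False
      have "S \<inter> E l \<in> I l" using S l by (simp add: feasible_def)
      moreover have "x \<in> E l \<Longrightarrow> (S \<inter> E l) \<union> {x} \<in> I l" using False l by (simp add: conflicts_def)
      ultimately show ?thesis
        by (cases "x \<in> E l") (auto elim: sub)
    qed
  qed
  then show ?thesis using S x by (auto simp: feasible_def)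
qed

text \<open>An element of \<open>OPT\<close> is not a loop, so the discarding of loops never affects
  \<open>OPT\<close>.\<close>

lemma exchange_ex_OPT:
  assumes S: "feasible X L E I S" and x: "x \<in> OPT"
  shows "\<exists>C. exchange L E I \<nu> x S C"
proof (rule exchange_ex[OF matchoid S])
  fix l assume l: "l \<in> L" "x \<in> E l"
  have "OPT \<inter> E l \<in> I l" using feasible_OPT l by (simp add: feasible_def)
  then show "{x} \<in> I l" by (rule indep_subset[OF matroid_E[OF l(1)]]) (use x l in blast)
qed

text \<open>When an element is exchanged out of the solution it is blamed on one matroid \<open>tag a\<close>; in all
  other matroids containing it, it can still be charged.\<close>

definition chargeable :: "'a set \<Rightarrow> 'a set \<Rightarrow> ('a \<Rightarrow> 'l) \<Rightarrow> 'l \<Rightarrow> 'a set" where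
  "chargeable S R tag l = (S \<union> {a\<in>R. tag a \<noteq> l}) \<inter> E l"

text \<open>\<open>Y\<close> is the set of elements seen so far (including \<open>S0\<close>), \<open>S\<close> the current solution and \<open>R\<close> the
  set of removed elements. \<open>\<chi>\<close> records the current incremental values on \<open>S\<close>, and on \<open>R\<close> those at
  the moment of removal; \<open>w l y\<close> is the incremental value of the element that \<open>y\<close> would have
  replaced in the matroid \<open>l\<close> when it was rejected.\<close>

definition pass_inv ::
  "'a set \<Rightarrow> 'a set \<Rightarrow> 'a set \<Rightarrow> ('a \<Rightarrow> real) \<Rightarrow> ('a \<Rightarrow> 'l) \<Rightarrow> ('l \<Rightarrow> 'a \<Rightarrow> real) \<Rightarrow> bool" where
  "pass_inv Y S R \<chi> tag w \<longleftrightarrow>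
     feasible X L E I S \<and> Y \<subseteq> X \<and> S \<union> R \<subseteq> Y \<and> S \<inter> R = {} \<and>
     (\<forall>k\<in>S. \<chi> k = \<nu> k S) \<and> (\<forall>k\<in>R. 0 \<le> \<chi> k) \<and>
     (\<forall>a\<in>R. tag a \<in> L \<and> a \<in> E (tag a)) \<and>
     \<beta> * sum \<chi> R \<le> f S - f S0 \<and>
     f (S \<union> R) \<le> f S + sum \<chi> R \<and>
     (\<forall>y\<in>OPT \<inter> Y - (S \<union> R).
        marginal f y (S \<union> R) \<le> (1 + \<beta>) * (\<Sum>l | l \<in> L \<and> y \<in> E l. w l y) \<and>
        (\<forall>l\<in>L. y \<in> E l \<longrightarrow> 0 < w l y \<longrightarrow>
           y \<in> span_in (I l) {k \<in> chargeable S R tag l. w l y \<le> \<chi> k}))"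

section \<open>Preservation of the invariant along a pass\<close>

lemma pass_inv_init:
  "feasible X L E I S0 \<Longrightarrow> pass_inv S0 S0 {} (\<lambda>k. \<nu> k S0) tag w"
  by (auto simp: pass_inv_def feasible_def)

lemma pass_inv_loop:
  assumes inv: "pass_inv Y S R \<chi> tag w" and x: "x \<in> X" "\<nexists>C. exchange L E I \<nu> x S C"
  shows "pass_inv (insert x Y) S R \<chi> tag w"
proof -
  have "x \<notin> OPT" using exchange_ex_OPT[of S x] inv x by (auto simp: pass_inv_def)
  then have "OPT \<inter> insert x Y = OPT \<inter> Y" by blast
  then show ?thesis using inv x by (auto simp: pass_inv_def)
qed

lemma pass_inv_reject:
  assumes inv: "pass_inv Y S R \<chi> tag w" and x: "x \<in> X" "x \<notin> Y"
    and ex: "exchange L E I \<nu> x S C"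
    and rej: "\<not> marginal f x S \<ge> 0 + (1 + \<beta>) * (\<Sum>c\<in>C. \<nu> c S)"
  shows "\<exists>w. pass_inv (insert x Y) S R \<chi> tag w"
proof -
  have S: "feasible X L E I S" "S \<subseteq> X" and R: "S \<union> R \<subseteq> X" and \<chi>: "\<And>k. k \<in> S \<Longrightarrow> \<chi> k = \<nu> k S"
    using inv by (auto simp: pass_inv_def feasible_def)
  define N where "N = conflicts L E I x S"
  obtain c where c: "C = c ` N" "finite N"
    "\<And>l. l \<in> N \<Longrightarrow> c l \<in> swappable E I x S l"
    "\<And>l y. l \<in> N \<Longrightarrow> y \<in> swappable E I x S l \<Longrightarrow> \<nu> (c l) S \<le> \<nu> y S"
    "\<And>l. l \<in> N \<Longrightarrow> x \<in> span_in (I l) (swappable E I x S l)"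
    using exchangeE[OF ex S(1) x(1)] unfolding N_def by metis
  \<comment> \<open>The charge of \<open>x\<close> in a conflicting matroid is the value of its
    cheapest swap. Elsewhere it is 0, which imposes no span condition.\<close>
  define w' where "w' = (\<lambda>l y. if y = x then if l \<in> N then \<nu> (c l) S else 0 else w l y)"
  have cS: "c l \<in> S" if "l \<in> N" for l using c(3)[OF that] by (simp add: swappable_def)
  have \<nu>0: "0 \<le> \<nu> (c l) S" if "l \<in> N" for l
    using incr_value_nonneg[OF S(2)] cS[OF that] S(2) by blast
  have NL: "N = {l \<in> {l. l \<in> L \<and> x \<in> E l}. l \<in> N}" by (auto simp: N_def conflicts_def)
  have "marginal f x (S \<union> R) \<le> marginal f x S"
    by (rule marginal_antimono) (use R x in auto)
  also have "\<dots> \<le> (1 + \<beta>) * (\<Sum>c\<in>C. \<nu> c S)" using rej by simp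
  \<comment> \<open>One element may be chosen for several matroids; summing over matroids counts it
    repeatedly, which only increases a sum of nonnegative values.\<close>
  also have "\<dots> \<le> (1 + \<beta>) * (\<Sum>l\<in>N. \<nu> (c l) S)"
    unfolding c(1) using beta_nonneg sum_image_le[of N "\<lambda>y. \<nu> y S" c] c(2) \<nu>0
    by (intro mult_left_mono) (auto simp: o_def)
  also have "(\<Sum>l\<in>N. \<nu> (c l) S) = (\<Sum>l | l \<in> L \<and> x \<in> E l. w' l x)"
    unfolding w'_def using finite_matroids_at[OF x(1)]
    by (subst NL, subst sum.inter_filter) auto
  finally have "marginal f x (S \<union> R) \<le> (1 + \<beta>) * (\<Sum>l | l \<in> L \<and> x \<in> E l. w' l x)" .
  moreover have "x \<in> span_in (I l) {k \<in> chargeable S R tag l. w' l x \<le> \<chi> k}"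
    if "0 < w' l x" for l
  proof -
    have l: "l \<in> N" and wl: "w' l x = \<nu> (c l) S" using that by (auto simp: w'_def split: if_splits)
    \<comment> \<open>By minimality of \<open>c l\<close>, all swappable elements reach the
      threshold, and together they span \<open>x\<close>.\<close>
    have "swappable E I x S l \<subseteq> {k \<in> chargeable S R tag l. w' l x \<le> \<chi> k}"
      using c(4)[OF l] wl \<chi> by (auto simp: chargeable_def swappable_def)
    then show ?thesis using c(5)[OF l] span_in_mono by blast
  qed
  moreover have "w' l y = w l y" if "y \<in> Y" for l y using that x by (auto simp: w'_def)
  ultimately have "pass_inv (insert x Y) S R \<chi> tag w'"
    using inv x by (auto simp: pass_inv_def)
  then show ?thesis by blast
qed

text \<open>As \<open>x\<close> follows everything seen, the values of surviving elements can only
  rise, and acceptance gives \<open>x\<close> at least the value of each removed element. In the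
  matroid blamed for a removal, the rest of the circuit spans the removed element and stays
  chargeable with at least its value.\<close>

lemma pass_inv_accept:
  assumes inv: "pass_inv Y S R \<chi> tag w" and x: "x \<in> X" "x \<notin> Y"
    and prec: "\<And>t. t \<in> Y \<Longrightarrow> precedes ord t x \<and> \<not> precedes ord x t" "\<not> precedes ord x x"
    and ex: "exchange L E I \<nu> x S C"
    and acc: "marginal f x S \<ge> 0 + (1 + \<beta>) * (\<Sum>c\<in>C. \<nu> c S)"
  shows "\<exists>\<chi>' tag'. pass_inv (insert x Y) ((S - C) \<union> {x}) (R \<union> C) \<chi>' tag' w"
proof -
  have S: "feasible X L E I S" "S \<subseteq> X" and YX: "Y \<subseteq> X" and SRY: "S \<union> R \<subseteq> Y" and SR: "S \<inter> R = {}"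
    and \<chi>: "\<And>k. k \<in> S \<Longrightarrow> \<chi> k = \<nu> k S" and \<chi>0: "\<And>k. k \<in> R \<Longrightarrow> 0 \<le> \<chi> k"
    and tag: "\<And>a. a \<in> R \<Longrightarrow> tag a \<in> L \<and> a \<in> E (tag a)"
    and sum\<chi>: "\<beta> * sum \<chi> R \<le> f S - f S0" and fSR: "f (S \<union> R) \<le> f S + sum \<chi> R"
    and rejected: "\<And>y. y \<in> OPT \<inter> Y - (S \<union> R) \<Longrightarrow>
        marginal f y (S \<union> R) \<le> (1 + \<beta>) * (\<Sum>l | l \<in> L \<and> y \<in> E l. w l y) \<and>
        (\<forall>l\<in>L. y \<in> E l \<longrightarrow> 0 < w l y \<longrightarrow>
           y \<in> span_in (I l) {k \<in> chargeable S R tag l. w l y \<le> \<chi> k})"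
    using inv by (auto simp: pass_inv_def feasible_def)
  define N where "N = conflicts L E I x S"
  obtain c where c: "C = c ` N" "finite N"
    "\<And>l. l \<in> N \<Longrightarrow> c l \<in> swappable E I x S l"
    "\<And>l y. l \<in> N \<Longrightarrow> y \<in> swappable E I x S l \<Longrightarrow> \<nu> (c l) S \<le> \<nu> y S"
    "\<And>l. l \<in> N \<Longrightarrow> c l \<in> span_in (I l) (insert x (swappable E I x S l - {c l}))"
    using exchangeE[OF ex S(1) x(1)] unfolding N_def by metis
  have NL: "l \<in> L \<and> x \<in> E l" if "l \<in> N" for l using that by (simp add: N_def conflicts_def)
  have cS: "c l \<in> S \<inter> E l" if "l \<in> N" for l using c(3)[OF that] by (simp add: swappable_def)
  have CS: "C \<subseteq> S" using c(1) cS by blast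
  have \<nu>0: "0 \<le> \<nu> k S" if "k \<in> S" for k using incr_value_nonneg[OF S(2)] that S(2) by blast
  define S' where "S' = (S - C) \<union> {x}"
  define R' where "R' = R \<union> C"
  define \<chi>' where "\<chi>' = (\<lambda>k. if k \<in> S' then \<nu> k S' else \<chi> k)"
  \<comment> \<open>An element chosen for several matroids is blamed on just one of them.\<close>
  define tag' where "tag' = (\<lambda>a. if a \<in> C then SOME l. l \<in> N \<and> c l = a else tag a)"
  have tagC: "tag' a \<in> N \<and> c (tag' a) = a" if a: "a \<in> C" for a
  proof -
    have "\<exists>l. l \<in> N \<and> c l = a" using a c(1) by blast
    then have "(SOME l. l \<in> N \<and> c l = a) \<in> N \<and> c (SOME l. l \<in> N \<and> c l = a) = a"
      by (rule someI_ex)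
    then show ?thesis using a by (simp add: tag'_def)
  qed
  have S': "S' \<subseteq> X" "feasible X L E I S'"
    using feasible_exchange[OF ex S(1) x(1)] by (auto simp: S'_def feasible_def)
  have xSR: "x \<notin> S" "x \<notin> R" using SRY x by auto
  have S'R': "S' \<inter> R' = {}" using SR xSR CS by (auto simp: S'_def R'_def)
  have union: "S' \<union> R' = (S \<union> R) \<union> {x}" using CS by (auto simp: S'_def R'_def)
  have fin: "finite R" "finite C" "finite S"
    by (rule finite_subset[OF _ finite_ground]; use SRY YX CS in blast)+
  have sumR': "sum \<chi>' R' = sum \<chi> R + (\<Sum>c\<in>C. \<nu> c S)"
  proof -
    have "sum \<chi>' R' = sum \<chi> R'"
      by (rule sum.cong) (use S'R' in \<open>auto simp: \<chi>'_def\<close>)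
    also have "\<dots> = sum \<chi> R + sum \<chi> C"
      unfolding R'_def using fin SR CS by (intro sum.union_disjoint) auto
    also have "sum \<chi> C = (\<Sum>c\<in>C. \<nu> c S)" using \<chi> CS by (intro sum.cong) auto
    finally show ?thesis .
  qed
  \<comment> \<open>The predecessors of \<open>x\<close> in \<open>S'\<close> all lie in
    \<open>S\<close>.\<close>
  have val_new: "marginal f x S \<le> \<nu> x S'"
    unfolding incr_value_def
    by (rule marginal_antimono) (use S(2) x(1) prec(2) in \<open>auto simp: S'_def\<close>)
  \<comment> \<open>\<open>x\<close> does not precede \<open>k\<close>, so the exchange can only
    delete predecessors of \<open>k\<close>.\<close>
  have val_old: "\<nu> k S \<le> \<nu> k S'" if "k \<in> S - C" for k
    unfolding incr_value_def
    by (rule marginal_antimono) (use S(2) prec(1)[of k] SRY that in \<open>auto simp: S'_def\<close>)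
  have sumC: "\<nu> k S \<le> marginal f x S" if "k \<in> C" for k
  proof -
    have "\<nu> k S \<le> (\<Sum>c\<in>C. \<nu> c S)"
      by (rule member_le_sum[OF that]) (use \<nu>0 CS fin in auto)
    also have "\<dots> \<le> (1 + \<beta>) * (\<Sum>c\<in>C. \<nu> c S)"
    proof -
      have "0 \<le> \<beta> * (\<Sum>c\<in>C. \<nu> c S)"
        by (intro mult_nonneg_nonneg beta_nonneg sum_nonneg) (use \<nu>0 CS in auto)
      then show ?thesis by (simp add: algebra_simps)
    qed
    finally show ?thesis using acc by simp
  qed
  \<comment> \<open>Removing \<open>C\<close> costs at most its incremental values, and adding
    \<open>x\<close> to the smaller set gains at least its marginal over \<open>S\<close>.\<close>
  have fS': "f S + marginal f x S - (\<Sum>c\<in>C. \<nu> c S) \<le> f S'"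
  proof -
    have "marginal f x S \<le> marginal f x (S - C)"
      by (rule marginal_antimono) (use S x in auto)
    also have "\<dots> = f S' - f (S - C)" by (simp add: marginal_def S'_def)
    finally show ?thesis
      using remove_le_sum_incr_value[OF distinct_ord set_ord S(2) CS] by linarith
  qed
  have \<chi>'_ge: "\<chi> k \<le> \<chi>' k" if "k \<in> S \<union> R" for k
    using that val_old[of k] \<chi>[of k] xSR by (auto simp: \<chi>'_def S'_def)
  \<comment> \<open>Only elements removed now and blamed on \<open>l\<close> cease to be chargeable
    in \<open>l\<close>; all others keep or increase their value.\<close>
  have span: "{k \<in> chargeable S R tag l. \<theta> \<le> \<chi> k}
      \<subseteq> span_in (I l) {k \<in> chargeable S' R' tag' l. \<theta> \<le> \<chi>' k}" (is "_ \<subseteq> span_in _ ?K'")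
    if l: "l \<in> L" for l \<theta>
  proof
    fix k assume k: "k \<in> {k \<in> chargeable S R tag l. \<theta> \<le> \<chi> k}"
    have super: "?K' \<subseteq> span_in (I l) ?K'" by (rule span_in_superset[OF matroid_E[OF l]])
    show "k \<in> span_in (I l) ?K'"
    proof (cases "k \<in> C \<and> tag' k = l")
      case False
      then have "k \<in> chargeable S' R' tag' l"
        using k SR CS by (auto simp: chargeable_def S'_def R'_def tag'_def)
      moreover have "\<theta> \<le> \<chi>' k" using k \<chi>'_ge[of k] by (auto simp: chargeable_def)
      ultimately show ?thesis using super by blast
    next
      case True
      then have lN: "l \<in> N" and cl: "c l = k" using tagC[of k] by auto
      have kS: "k \<in> S" using True CS by blast
      have \<theta>: "\<theta> \<le> \<nu> k S" using k \<chi>[OF kS] by simp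
      have "insert x (swappable E I x S l - {c l}) \<subseteq> ?K'"
      proof
        fix y assume y: "y \<in> insert x (swappable E I x S l - {c l})"
        show "y \<in> ?K'"
        proof (cases "y = x")
          case True
          have "\<theta> \<le> \<nu> x S'" using \<theta> sumC[of k] val_new \<open>k \<in> C \<and> _\<close> by linarith
          then show ?thesis using True NL[OF lN] by (simp add: chargeable_def S'_def \<chi>'_def)
        next
          case False
          then have y': "y \<in> swappable E I x S l" "y \<noteq> c l" using y by auto
          then have yS: "y \<in> S" "y \<in> E l" by (auto simp: swappable_def)
          have "\<theta> \<le> \<nu> y S" using c(4)[OF lN y'(1)] cl \<theta> by simp
          then have "\<theta> \<le> \<chi>' y" using \<chi>'_ge[of y] \<chi>[of y] yS by simp
          \<comment> \<open>If \<open>y\<close> is removed too, it is blamed on another matroid,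
            because the element blamed on \<open>l\<close> can only be \<open>c l\<close>.\<close>
          moreover have "y \<in> chargeable S' R' tag' l"
            using tagC[of y] y'(2) yS by (auto simp: chargeable_def S'_def R'_def)
          ultimately show ?thesis by blast
        qed
      qed
      then show ?thesis using c(5)[OF lN] cl span_in_mono by blast
    qed
  qed
  have "feasible X L E I S' \<and> insert x Y \<subseteq> X \<and> S' \<union> R' \<subseteq> insert x Y \<and> S' \<inter> R' = {}"
    using S' YX x(1) SRY union S'R' by auto
  moreover have "\<forall>k\<in>S'. \<chi>' k = \<nu> k S'" by (simp add: \<chi>'_def)
  moreover have "\<forall>k\<in>R'. 0 \<le> \<chi>' k"
  proof
    fix k assume "k \<in> R'"
    then consider "k \<in> R" | "k \<in> S" using CS by (auto simp: R'_def)
    then have "0 \<le> \<chi> k" using \<chi>0 \<chi> \<nu>0 by cases auto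
    then show "0 \<le> \<chi>' k" using \<chi>'_ge[of k] \<open>k \<in> R'\<close> CS by (force simp: R'_def)
  qed
  moreover have "\<forall>a\<in>R'. tag' a \<in> L \<and> a \<in> E (tag' a)"
  proof
    fix a assume "a \<in> R'"
    then show "tag' a \<in> L \<and> a \<in> E (tag' a)"
      using tagC[of a] NL[of "tag' a"] cS[of "tag' a"] tag[of a] by (cases "a \<in> C") (auto simp: R'_def tag'_def)
  qed
  moreover have "\<beta> * sum \<chi>' R' \<le> f S' - f S0"
  proof -
    \<comment> \<open>Acceptance pays \<open>1 + \<beta>\<close> times the removed value; one share
      covers the loss and the share \<open>\<beta>\<close> remains as net gain.\<close>
    have "\<beta> * sum \<chi>' R' = \<beta> * sum \<chi> R + \<beta> * (\<Sum>c\<in>C. \<nu> c S)"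
      by (simp add: sumR' distrib_left)
    moreover have "(1 + \<beta>) * (\<Sum>c\<in>C. \<nu> c S) = (\<Sum>c\<in>C. \<nu> c S) + \<beta> * (\<Sum>c\<in>C. \<nu> c S)"
      by (simp add: distrib_right)
    ultimately show ?thesis using sum\<chi> fS' acc by linarith
  qed
  moreover have "f (S' \<union> R') \<le> f S' + sum \<chi>' R'"
  proof -
    have "f (S' \<union> R') = f (S \<union> R) + marginal f x (S \<union> R)"
      by (simp add: union marginal_def)
    moreover have "marginal f x (S \<union> R) \<le> marginal f x S"
      by (rule marginal_antimono) (use SRY YX x in auto)
    ultimately show ?thesis using fSR fS' sumR' by linarith
  qed
  moreover have "\<forall>y\<in>OPT \<inter> insert x Y - (S' \<union> R').
        marginal f y (S' \<union> R') \<le> (1 + \<beta>) * (\<Sum>l | l \<in> L \<and> y \<in> E l. w l y) \<and>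
        (\<forall>l\<in>L. y \<in> E l \<longrightarrow> 0 < w l y \<longrightarrow>
           y \<in> span_in (I l) {k \<in> chargeable S' R' tag' l. w l y \<le> \<chi>' k})"
  proof
    fix y assume "y \<in> OPT \<inter> insert x Y - (S' \<union> R')"
    then have y: "y \<in> OPT \<inter> Y - (S \<union> R)" using union by blast
    have "marginal f y (S' \<union> R') \<le> marginal f y (S \<union> R)"
      by (rule marginal_antimono) (use y union SRY YX x in auto)
    then have "marginal f y (S' \<union> R') \<le> (1 + \<beta>) * (\<Sum>l | l \<in> L \<and> y \<in> E l. w l y)"
      using rejected[OF y] by linarith
    moreover have "y \<in> span_in (I l) {k \<in> chargeable S' R' tag' l. w l y \<le> \<chi>' k}"
      if "l \<in> L" "y \<in> E l" "0 < w l y" for l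
      using rejected[OF y] that
        span_in_trans[OF matroid_E[OF that(1)] span[OF that(1), of "w l y"]] by blast
    ultimately show "marginal f y (S' \<union> R') \<le> (1 + \<beta>) * (\<Sum>l | l \<in> L \<and> y \<in> E l. w l y) \<and>
        (\<forall>l\<in>L. y \<in> E l \<longrightarrow> 0 < w l y \<longrightarrow>
           y \<in> span_in (I l) {k \<in> chargeable S' R' tag' l. w l y \<le> \<chi>' k})" by blast
  qed
  ultimately have "pass_inv (insert x Y) S' R' \<chi>' tag' w"
    unfolding pass_inv_def by (intro conjI) blast+
  then show ?thesis unfolding S'_def R'_def by blast
qed

text \<open>\<open>us\<close> is the part of the pretend order already seen, beginning with
  \<open>S0\<close>. Each processed arrival comes directly after \<open>us\<close>, and at the end
  \<open>us\<close> is the whole order, so the seen set is \<open>X\<close>.\<close>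

lemma pass_inv_run:
  assumes "local_search_run f L E I \<nu> 0 \<beta> S0 xs S S'"
    and "ord = us @ filter (\<lambda>x. x \<notin> S0) xs" and "pass_inv (set us) S R \<chi> tag w"
  shows "\<exists>R \<chi> tag w. pass_inv X S' R \<chi> tag w"
  using assms
proof (induction arbitrary: us R \<chi> tag w)
  case (Nil S)
  then show ?case using set_ord by auto
next
  case (Cons x S S' xs S'')
  show ?case
  proof (cases "x \<in> S0")
    case True
    then have "S' = S" using Cons.hyps(1) by (auto elim: local_search_step.cases)
    then show ?thesis using Cons.IH[of us] Cons.prems True by simp
  next
    case False
    let ?vs = "filter (\<lambda>x. x \<notin> S0) xs"
    have ord: "ord = us @ x # ?vs" using Cons.prems(1) False by simp
    then have x: "x \<in> X" "x \<notin> set us" using set_ord distinct_ord by auto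
    have prec: "precedes ord t x \<and> \<not> precedes ord x t" if "t \<in> set us" for t
      using precedes_append[of us x ?vs t] that distinct_ord unfolding ord by simp
    have irrefl: "\<not> precedes ord x x"
      using distinct_ord by (auto simp: precedes_def nth_eq_iff_index_eq)
    have "\<exists>R \<chi> tag w. pass_inv (insert x (set us)) S' R \<chi> tag w"
      using Cons.hyps(1)
    proof cases
      case discard
      then show ?thesis using False by simp
    next
      case (accept C)
      then show ?thesis
        using pass_inv_accept[OF Cons.prems(2) x prec irrefl accept(3,4)] by blast
    next
      case (reject C)
      then show ?thesis
        using pass_inv_reject[OF Cons.prems(2) x reject(3,4)] by blast
    next
      case loop
      then show ?thesis
        using pass_inv_loop[OF Cons.prems(2) x(1) loop(3)] by blast
    qed
    then obtain R \<chi> tag w where "pass_inv (set (us @ [x])) S' R \<chi> tag w" by auto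
    then show ?thesis by (rule Cons.IH[rotated]) (simp add: ord)
  qed
qed

section \<open>Charging the rejected elements at the end of a pass\<close>

lemma sum_rejected_le_sum_chargeable:
  assumes inv: "pass_inv X S R \<chi> tag w" and l: "l \<in> L" and Q: "Q = OPT - (S \<union> R)"
  shows "(\<Sum>y | y \<in> Q \<and> y \<in> E l. w l y) \<le> sum \<chi> (chargeable S R tag l)"
proof -
  have S: "S \<subseteq> X" "R \<subseteq> X" and OPT: "OPT \<subseteq> X" "OPT \<inter> E l \<in> I l"
    using inv feasible_OPT l by (auto simp: pass_inv_def feasible_def)
  have \<chi>0: "0 \<le> \<chi> k" if "k \<in> S \<union> R" for k
    using inv that incr_value_nonneg[OF S(1)] S by (auto simp: pass_inv_def)
  have "finite {y. y \<in> Q \<and> y \<in> E l}"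
    by (rule finite_subset[OF _ finite_ground]) (use OPT Q in auto)
  moreover have fin: "finite (chargeable S R tag l)"
    by (rule finite_subset[OF _ finite_ground]) (use S in \<open>auto simp: chargeable_def\<close>)
  \<comment> \<open>Rejected elements of \<open>OPT\<close> with charge at least \<theta> are
    independent in \<open>l\<close>. Each is spanned by the level set at its own charge, which is
    contained in the level set at \<theta>.\<close>
  moreover have "card {y \<in> {y. y \<in> Q \<and> y \<in> E l}. \<theta> \<le> w l y}
      \<le> card {k \<in> chargeable S R tag l. \<theta> \<le> \<chi> k}" if \<theta>: "0 < \<theta>" for \<theta>
  proof (rule indep_card_le_span[OF matroid_E[OF l]])
    show "{y \<in> {y. y \<in> Q \<and> y \<in> E l}. \<theta> \<le> w l y} \<in> I l"
      by (rule indep_subset[OF matroid_E[OF l] OPT(2)]) (use Q in auto)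
    show "{y \<in> {y. y \<in> Q \<and> y \<in> E l}. \<theta> \<le> w l y}
        \<subseteq> span_in (I l) {k \<in> chargeable S R tag l. \<theta> \<le> \<chi> k}"
    proof
      fix y assume "y \<in> {y \<in> {y. y \<in> Q \<and> y \<in> E l}. \<theta> \<le> w l y}"
      then have y: "y \<in> OPT \<inter> X - (S \<union> R)" "y \<in> E l" "0 < w l y" "\<theta> \<le> w l y"
        using Q OPT \<theta> by auto
      then have "y \<in> span_in (I l) {k \<in> chargeable S R tag l. w l y \<le> \<chi> k}"
        using inv l unfolding pass_inv_def by blast
      moreover have "{k \<in> chargeable S R tag l. w l y \<le> \<chi> k}
          \<subseteq> {k \<in> chargeable S R tag l. \<theta> \<le> \<chi> k}" using y(4) by auto
      ultimately show "y \<in> span_in (I l) {k \<in> chargeable S R tag l. \<theta> \<le> \<chi> k}"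
        using span_in_mono by blast
    qed
  qed (use fin in simp)
  ultimately show ?thesis
    by (intro sum_le_if_thresholds) (auto intro: \<chi>0 simp: chargeable_def)
qed

text \<open>Double counting of pairs of element and matroid: an element of \<open>S\<close> is
  charged in at most \<open>p\<close> matroids, one of \<open>R\<close> in at most
  \<open>p - 1\<close>.\<close>

lemma pass_inv_bound:
  assumes inv: "pass_inv X S R \<chi> tag w"
  shows "0 \<le> sum \<chi> R"
    and "f OPT \<le> f S + sum \<chi> R
      + (1 + \<beta>) * (real p * f S + (real p - 1) * sum \<chi> R)"
proof -
  have S: "S \<subseteq> X" "R \<subseteq> X" "S \<inter> R = {}" and OPT: "OPT \<subseteq> X"
    and \<chi>: "\<And>k. k \<in> S \<Longrightarrow> \<chi> k = \<nu> k S"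
    and tag: "\<And>a. a \<in> R \<Longrightarrow> tag a \<in> L \<and> a \<in> E (tag a)"
    and fSR: "f (S \<union> R) \<le> f S + sum \<chi> R"
    using inv feasible_OPT by (auto simp: pass_inv_def feasible_def)
  have \<chi>0: "0 \<le> \<chi> k" if "k \<in> S \<union> R" for k
    using inv that incr_value_nonneg[OF S(1)] S by (auto simp: pass_inv_def)
  then show "0 \<le> sum \<chi> R" by (intro sum_nonneg) auto
  define Q where "Q = OPT - (S \<union> R)"
  have fin: "finite S" "finite R" "finite Q"
    by (rule finite_subset[OF _ finite_ground]; use S OPT Q_def in blast)+
  \<comment> \<open>\<open>L\<close> may be infinite. The matroids that contain an element of
    \<open>X\<close> form a finite set, over which the sums can be swapped.\<close>
  define L' where "L' = (\<Union>x\<in>X. {l\<in>L. x \<in> E l})"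
  have L': "finite L'" "L' \<subseteq> L"
    using finite_matroids_at finite_ground by (auto simp: L'_def)
  have L'X: "{l. l \<in> L \<and> y \<in> E l} = {l. l \<in> L' \<and> y \<in> E l}" if "y \<in> X" for y
    using that by (auto simp: L'_def)
  have "f OPT \<le> f ((S \<union> R) \<union> Q)"
    by (rule f_mono) (use S OPT Q_def in auto)
  also have "\<dots> \<le> f (S \<union> R) + (\<Sum>y\<in>Q. marginal f y (S \<union> R))"
    by (rule union_le_sum_marginal[OF fin(3)]) (use S OPT Q_def in auto)
  also have "(\<Sum>y\<in>Q. marginal f y (S \<union> R))
      \<le> (\<Sum>y\<in>Q. (1 + \<beta>) * (\<Sum>l | l \<in> L \<and> y \<in> E l. w l y))"
  proof (rule sum_mono)
    fix y assume "y \<in> Q"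
    then have "y \<in> OPT \<inter> X - (S \<union> R)" using OPT Q_def by blast
    then show "marginal f y (S \<union> R) \<le> (1 + \<beta>) * (\<Sum>l | l \<in> L \<and> y \<in> E l. w l y)"
      using inv unfolding pass_inv_def by blast
  qed
  also have "\<dots> = (1 + \<beta>) * (\<Sum>y\<in>Q. \<Sum>l | l \<in> L' \<and> y \<in> E l. w l y)"
    unfolding sum_distrib_left[symmetric]
    using L'X OPT Q_def by (intro arg_cong2[where f = "(*)"] sum.cong refl) auto
  also have "(\<Sum>y\<in>Q. \<Sum>l | l \<in> L' \<and> y \<in> E l. w l y)
      = (\<Sum>l\<in>L'. \<Sum>y | y \<in> Q \<and> y \<in> E l. w l y)"
    by (rule sum.swap_restrict[OF fin(3) L'(1)])
  also have "\<dots> \<le> real p * f S + (real p - 1) * sum \<chi> R"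
  proof -
    have "(\<Sum>l\<in>L'. \<Sum>y | y \<in> Q \<and> y \<in> E l. w l y) \<le> (\<Sum>l\<in>L'. sum \<chi> (chargeable S R tag l))"
      using sum_rejected_le_sum_chargeable[OF inv _ Q_def] L'(2) by (intro sum_mono) blast
    also have "\<dots> = (\<Sum>l\<in>L'. \<Sum>k | k \<in> S \<union> R \<and> (k \<in> E l \<and> (k \<in> S \<or> tag k \<noteq> l)). \<chi> k)"
      by (intro sum.cong refl) (auto simp: chargeable_def)
    also have "\<dots> = (\<Sum>k\<in>S \<union> R. \<Sum>l | l \<in> L' \<and> (k \<in> E l \<and> (k \<in> S \<or> tag k \<noteq> l)). \<chi> k)"
      by (rule sum.swap_restrict) (use L'(1) fin in auto)
    also have "\<dots> = (\<Sum>k\<in>S. \<Sum>l | l \<in> L' \<and> (k \<in> E l \<and> (k \<in> S \<or> tag k \<noteq> l)). \<chi> k)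
        + (\<Sum>k\<in>R. \<Sum>l | l \<in> L' \<and> (k \<in> E l \<and> (k \<in> S \<or> tag k \<noteq> l)). \<chi> k)"
      by (rule sum.union_disjoint[OF fin(1,2) S(3)])
    also have "\<dots> \<le> (\<Sum>k\<in>S. real p * \<chi> k) + (\<Sum>k\<in>R. (real p - 1) * \<chi> k)"
    proof (intro add_mono sum_mono)
      fix k assume k: "k \<in> S"
      then have kX: "k \<in> X" using S by blast
      have *: "{l. l \<in> L' \<and> (k \<in> E l \<and> (k \<in> S \<or> tag k \<noteq> l))} = {l\<in>L. k \<in> E l}"
        using L'X[OF kX] k by auto
      show "(\<Sum>l | l \<in> L' \<and> (k \<in> E l \<and> (k \<in> S \<or> tag k \<noteq> l)). \<chi> k) \<le> real p * \<chi> k"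
        unfolding * sum_constant using card_matroids_at[OF kX] \<chi>0[of k] k
        by (intro mult_right_mono) auto
    next
      fix k assume k: "k \<in> R"
      then have kX: "k \<in> X" and tk: "tag k \<in> {l\<in>L. k \<in> E l}" using S tag by auto
      have *: "{l. l \<in> L' \<and> (k \<in> E l \<and> (k \<in> S \<or> tag k \<noteq> l))} = {l\<in>L. k \<in> E l} - {tag k}"
        using L'X[OF kX] k S by auto
      \<comment> \<open>The blamed matroid \<open>tag k\<close> contains \<open>k\<close> and is
        left out of the charging, which saves one.\<close>
      have "Suc (card ({l\<in>L. k \<in> E l} - {tag k})) \<le> p"
        using card_Suc_Diff1[OF finite_matroids_at[OF kX] tk] card_matroids_at[OF kX] by simp
      then have "real (card ({l\<in>L. k \<in> E l} - {tag k})) \<le> real p - 1" by linarith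
      then show "(\<Sum>l | l \<in> L' \<and> (k \<in> E l \<and> (k \<in> S \<or> tag k \<noteq> l)). \<chi> k) \<le> (real p - 1) * \<chi> k"
        unfolding * sum_constant using \<chi>0[of k] k by (intro mult_right_mono) auto
    qed
    also have "\<dots> = real p * sum \<chi> S + (real p - 1) * sum \<chi> R"
      by (simp add: sum_distrib_left)
    also have "sum \<chi> S = f S - f {}"
      using sum_incr_value[OF distinct_ord set_ord S(1)] \<chi> by simp
    also have "real p * (f S - f {}) \<le> real p * f S"
      using nonneg[of "{}"] by (intro mult_left_mono) auto
    finally show ?thesis by simp
  qed
  finally show "f OPT \<le> f S + sum \<chi> R + (1 + \<beta>) * (real p * f S + (real p - 1) * sum \<chi> R)"
    using fSR beta_nonneg by (auto intro: mult_left_mono)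
qed

lemma pass_bound:
  assumes run: "streaming_local_search f L E I ord 0 \<beta> xs S0 S"
    and S0: "feasible X L E I S0"
    and ord: "ord = us @ filter (\<lambda>x. x \<notin> S0) xs" "set us = S0"
  obtains D where "feasible X L E I S" "0 \<le> D" "\<beta> * D \<le> f S - f S0"
    "f OPT \<le> f S + D + (1 + \<beta>) * (real p * f S + (real p - 1) * D)"
proof -
  obtain R \<chi> tag w where inv: "pass_inv X S R \<chi> tag w"
    using pass_inv_run[OF _ ord(1), of S0 S] pass_inv_init[OF S0] run
    unfolding streaming_local_search_def ord(2) by blast
  then show ?thesis
    using that[of "sum \<chi> R"] pass_inv_bound[OF inv] by (auto simp: pass_inv_def)
qed

end


section \<open>The recursion for the approximation ratio\<close>

text \<open>With \<beta> = 1 the coefficients are \<open>1 + 2 * p\<close> for \<open>v\<close> and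
  \<open>2 * p - 1\<close> for \<open>D\<close>; since \<open>D \<le> v\<close>, they add up to
  \<open>4 * p\<close>.\<close>

lemma first_pass_ratio:
  fixes p u v D OPT :: real
  assumes "1 \<le> p" "0 \<le> u" "D \<le> v - u"
    and "OPT \<le> v + D + 2 * (p * v + (p - 1) * D)"
  shows "OPT \<le> 4 * p * v"
proof -
  have "(2 * p - 1) * D \<le> (2 * p - 1) * (v - u)"
    using assms by (intro mult_left_mono) auto
  moreover have "0 \<le> (2 * p - 1) * u" using assms by simp
  ultimately show ?thesis using assms(4) by (simp add: algebra_simps)
qed

text \<open>Eliminating \<open>D\<close> and then \<open>u\<close> leaves the factor
  \<open>g * p * (1 + \<beta>)\<^sup>2 / (g * \<beta> + c)\<close>, whose denominator equals
  \<open>q * \<beta> + p\<close>. The given \<beta> minimizes this factor over nonnegative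
  values.\<close>

lemma later_pass_ratio:
  fixes p u v D OPT g :: real
  assumes p: "1 \<le> p" and g: "1 + p < g" and \<beta>: "\<beta> = (g - 1 - p) / (g - 1 + p)"
    and D: "\<beta> * D \<le> v - u" and OPT: "OPT \<le> g * u"
    and bound: "OPT \<le> v + D + (1 + \<beta>) * (p * v + (p - 1) * D)"
  shows "OPT \<le> 4 * p * (g * (g - 1) / (g - 1 + p)\<^sup>2) * v"
proof -
  define q where "q = g - 1 + p"
  have q: "0 < q" "g - 1 + p = q" using g p by (auto simp: q_def)
  have \<beta>0: "0 < \<beta>" using \<beta> g q by simp
  have \<beta>q: "\<beta> * q = g - 1 - p" using \<beta> q by simp
  have \<beta>1q: "(1 + \<beta>) * q = 2 * (g - 1)"
    unfolding distrib_right \<beta>q by (simp add: q_def)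
  then have \<beta>1: "1 + \<beta> = 2 * (g - 1) / q" using q(1) by (simp add: nonzero_eq_divide_eq)
  \<comment> \<open>\<open>c\<close> is the coefficient \<open>1 + (1 + \<beta>) * (p - 1)\<close>
    of \<open>D\<close> in the bound.\<close>
  define c where "c = (1 + \<beta>) * p - \<beta>"
  have c: "0 \<le> c"
  proof -
    have "\<beta> * 1 \<le> \<beta> * p" using \<beta>0 p by (intro mult_left_mono) auto
    then show ?thesis using p by (simp add: c_def algebra_simps)
  qed
  have gc: "g * \<beta> + c = g - 1"
  proof -
    have "(g * \<beta> + c) * q = g * (\<beta> * q) + p * ((1 + \<beta>) * q) - \<beta> * q"
      by (simp add: c_def algebra_simps)
    also note \<beta>q
    also note \<beta>1q
    also have "g * (g - 1 - p) + p * (2 * (g - 1)) - (g - 1 - p) = (g - 1) * q"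
      by (simp add: q_def algebra_simps)
    finally show ?thesis using q by simp
  qed
  have "\<beta> * OPT \<le> \<beta> * (v + D + (1 + \<beta>) * (p * v + (p - 1) * D))"
    using bound \<beta>0 by simp
  also have "\<dots> = \<beta> * (1 + (1 + \<beta>) * p) * v + c * (\<beta> * D)"
    by (simp add: c_def algebra_simps)
  also have "c * (\<beta> * D) \<le> c * (v - u)" using D c by (intro mult_left_mono)
  also have "\<beta> * (1 + (1 + \<beta>) * p) * v + c * (v - u) = p * (1 + \<beta>)\<^sup>2 * v - c * u"
    by (simp add: c_def algebra_simps power2_eq_square)
  finally have "g * (\<beta> * OPT) \<le> g * (p * (1 + \<beta>)\<^sup>2 * v - c * u)"
    using g p by (intro mult_left_mono) auto
  \<comment> \<open>Adding \<open>c\<close> times the previous guarantee cancels the term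
    \<open>g * c * u\<close>.\<close>
  moreover have "c * OPT \<le> c * (g * u)" using OPT c by (intro mult_left_mono)
  ultimately have "(g * \<beta> + c) * OPT \<le> g * (p * (1 + \<beta>)\<^sup>2 * v)"
    by (simp add: algebra_simps)
  also have "\<dots> = (g - 1) * (4 * p * (g * (g - 1) / q\<^sup>2) * v)"
    unfolding \<beta>1 power_divide power_mult_distrib by (simp add: power2_eq_square algebra_simps)
  finally have "(g - 1) * OPT \<le> (g - 1) * (4 * p * (g * (g - 1) / q\<^sup>2) * v)"
    unfolding gc .
  moreover have "0 < g - 1" using g p by simp
  ultimately show ?thesis unfolding q(2) by (rule mult_left_le_imp_le)
qed

text \<open>With \<open>\<delta> = \<gamma> - 1 - p\<close> the recursion reads \<open>\<delta>' = \<delta> (4p\<^sup>2 + (3p - 1) \<delta>) / (2p + \<delta>)\<^sup>2\<close>, and it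
  implies \<open>1 / \<delta>' \<ge> 1 / \<delta> + 1 / (4p)\<close>.\<close>

lemma gamma_seq_bounds:
  assumes p: "1 \<le> p"
  shows "1 + real p < gamma_seq p (Suc i) \<and>
    real (Suc i) * (gamma_seq p (Suc i) - 1 - real p) \<le> 4 * real p"
proof (induction i)
  case 0
  then show ?case using p by simp
next
  case (Suc i)
  define P where "P = real p"
  define n where "n = real (Suc i)"
  define \<delta> where "\<delta> = gamma_seq p (Suc i) - 1 - P"
  have P: "1 \<le> P" using p by (simp add: P_def)
  have \<delta>: "0 < \<delta>" "n * \<delta> \<le> 4 * P" using Suc by (auto simp: \<delta>_def P_def n_def)
  let ?q = "2 * P + \<delta>"
  let ?m = "4 * P\<^sup>2 + (3 * P - 1) * \<delta>"
  have q: "0 < ?q" using P \<delta> by simp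
  have m: "0 < ?m" using P \<delta> by (intro add_pos_nonneg) auto
  have g: "gamma_seq p (Suc i) = 1 + P + \<delta>" by (simp add: \<delta>_def)
  have "gamma_seq p (Suc (Suc i)) = 4 * P * ((1 + P + \<delta>) * (P + \<delta>) / ?q\<^sup>2)"
    by (simp add: g P_def[symmetric] algebra_simps)
  then have \<delta>': "gamma_seq p (Suc (Suc i)) - 1 - P = \<delta> * ?m / ?q\<^sup>2"
    using q by (simp add: field_simps) (simp add: algebra_simps power2_eq_square)
  \<comment> \<open>What remains, \<open>(4 * P + \<delta>) * ?m \<le> 4 * P * ?q\<^sup>2\<close>,
    is the inequality between reciprocals with denominators cleared.\<close>
  have "(n + 1) * \<delta> \<le> 4 * P + \<delta>" using \<delta> by (simp add: algebra_simps)
  then have "(n + 1) * \<delta> * ?m \<le> (4 * P + \<delta>) * ?m" using m by (intro mult_right_mono) auto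
  also have "\<dots> \<le> 4 * P * ?q\<^sup>2"
  proof -
    have "4 * P * ?q\<^sup>2 - (4 * P + \<delta>) * ?m = 4 * P * \<delta> + (P + 1) * \<delta>\<^sup>2"
      by (simp add: algebra_simps power2_eq_square)
    also have "\<dots> \<ge> 0" using P \<delta> by simp
    finally show ?thesis by simp
  qed
  finally have "(n + 1) * (\<delta> * ?m / ?q\<^sup>2) \<le> 4 * P"
    using q by (simp add: field_simps)
  then have "(n + 1) * (gamma_seq p (Suc (Suc i)) - 1 - P) \<le> 4 * P"
    unfolding \<delta>' .
  moreover have "0 < gamma_seq p (Suc (Suc i)) - 1 - P"
    unfolding \<delta>' using \<delta> m q by simp
  moreover have "real (Suc (Suc i)) = n + 1" by (simp add: n_def)
  ultimately show ?case unfolding P_def by (simp del: gamma_seq.simps of_nat_Suc)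
qed

lemma gamma_seq_le:
  assumes "1 \<le> p" "1 \<le> i"
  shows "gamma_seq p i \<le> real p + 1 + 4 * real p / real i"
proof -
  obtain j where "i = Suc j" using assms by (cases i) auto
  then have "real i * (gamma_seq p i - 1 - real p) \<le> 4 * real p"
    using gamma_seq_bounds[OF assms(1), of j] by simp
  then have "gamma_seq p i - 1 - real p \<le> 4 * real p / real i"
    using assms by (simp add: field_simps)
  then show ?thesis by linarith
qed

lemma gamma_seq_0: "gamma_seq 0 i = 0"
  by (cases "(0::nat, i)" rule: gamma_seq.cases) auto

lemma beta_seq_nonneg: "0 \<le> beta_seq p i"
proof (cases "i \<le> 1")
  case False
  then obtain j where j: "i = Suc (Suc j)" by (metis One_nat_def Suc_le_mono le0 not0_implies_Suc)
  show ?thesis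
  proof (cases "p = 0")
    \<comment> \<open>Here all \<gamma> are 0, and the quotient is -1 divided by -1.\<close>
    case True
    then show ?thesis by (simp add: beta_seq_def gamma_seq_0)
  next
    case False
    then show ?thesis using gamma_seq_bounds[of p j] by (simp add: beta_seq_def j)
  qed
qed (simp add: beta_seq_def)

section \<open>Induction over the passes\<close>

theorem theorem3:
  fixes X :: "'a set" and f :: "'a set \<Rightarrow> real" and p d :: nat
    and L :: "'l set" and E :: "'l \<Rightarrow> 'a set" and I :: "'l \<Rightarrow> 'a set set"
    and OPT :: "'a set" and stream :: "nat \<Rightarrow> 'a list" and S :: "nat \<Rightarrow> 'a set"
  assumes "finite X"
    and "\<And>A. A \<subseteq> X \<Longrightarrow> f A \<ge> 0"
    and "submodular_on X f"
    and "mono_on (Pow X) f"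
    and "matchoid p X L E I"
    and "is_arg_max f (feasible X L E I) OPT"
    and "\<And>i. i \<in> {1..d} \<Longrightarrow> distinct (stream i) \<and> set (stream i) = X"
    and "multipass_local_search f L E I 0 (beta_seq p) d stream S"
  shows "(\<forall>i\<in>{1..d}. (real p + 1 + 4 * real p / real i) * f (S i) \<ge> f OPT) \<and>
         (\<forall>\<epsilon>::real. \<epsilon> > 0 \<longrightarrow>
            (\<forall>i\<in>{1..d}. real i \<ge> 4 * real p / \<epsilon> \<longrightarrow> (real p + 1 + \<epsilon>) * f (S i) \<ge> f OPT))"
proof -
  interpret monotone_submodular X f
    using assms(1-4) by unfold_locales
  have OPT: "feasible X L E I OPT" using assms(6) by (simp add: is_arg_max_def)
  have S0: "S 0 = {}"
    and run: "\<And>i. i \<in> {1..d} \<Longrightarrow> streaming_local_search f L E I (pretend_order stream S i) 0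
      (beta_seq p i) (stream i) (S (i - 1)) (S i)"
    using assms(8) by (auto simp: multipass_local_search_def)
  have pass: "\<exists>D. feasible X L E I (S (Suc i)) \<and> 0 \<le> D \<and>
      beta_seq p (Suc i) * D \<le> f (S (Suc i)) - f (S i) \<and>
      f OPT \<le> f (S (Suc i)) + D + (1 + beta_seq p (Suc i)) *
        (real p * f (S (Suc i)) + (real p - 1) * D)"
    if i: "Suc i \<le> d" and Si: "feasible X L E I (S i)" and d: "distinct (pretend_order stream S (Suc i))"
      and X: "set (pretend_order stream S (Suc i)) = X" and sub: "S i \<subseteq> set (pretend_order stream S i)"
    for i
  proof -
    interpret local_search_pass X f p L E I "pretend_order stream S (Suc i)" "beta_seq p (Suc i)"
      "S i" OPT
      using assms(5) OPT d X beta_seq_nonneg by unfold_locales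
    have "streaming_local_search f L E I (pretend_order stream S (Suc i)) 0 (beta_seq p (Suc i))
        (stream (Suc i)) (S i) (S (Suc i))"
      using run[of "Suc i"] i by simp
    then show ?thesis
      by (rule pass_bound[OF _ Si, of _ _ "filter (\<lambda>x. x \<in> S i) (pretend_order stream S i)"])
        (use sub in auto)
  qed
  have order: "distinct (pretend_order stream S (Suc i)) \<and> set (pretend_order stream S (Suc i)) = X"
    if "Suc i \<le> d" "feasible X L E I (S i)" "distinct (pretend_order stream S i)"
      "S i \<subseteq> set (pretend_order stream S i)" for i
    using that assms(7)[of "Suc i"] by (auto simp: feasible_def)
  \<comment> \<open>The inclusion ensures that filtering the old pretend order by \<open>S i\<close>
    lists all of \<open>S i\<close>, so the next pretend order enumerates \<open>X\<close>. It holds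
    at 0, where both sides are empty.\<close>
  have good: "feasible X L E I (S i) \<and> distinct (pretend_order stream S i) \<and>
      S i \<subseteq> set (pretend_order stream S i)" if "i \<le> d" for i
    using that
  proof (induction i)
    case 0
    show ?case using S0 assms(5) by (auto simp: feasible_def matchoid_def matroid_def)
  next
    case (Suc i)
    then have IH: "feasible X L E I (S i)" "distinct (pretend_order stream S i)"
      "S i \<subseteq> set (pretend_order stream S i)" by simp_all
    note ord = order[OF Suc.prems IH]
    then have "feasible X L E I (S (Suc i))"
      using pass[OF Suc.prems IH(1) _ _ IH(3)] by blast
    then show ?case using ord by (simp add: feasible_def)
  qed
  have bound: "\<exists>D\<ge>0. beta_seq p (Suc i) * D \<le> f (S (Suc i)) - f (S i) \<and>
      f OPT \<le> f (S (Suc i)) + D + (1 + beta_seq p (Suc i)) *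
        (real p * f (S (Suc i)) + (real p - 1) * D)" if "Suc i \<le> d" for i
    using pass[of i] order[of i] good[of i] that by auto
  have f0: "0 \<le> f (S i)" if "i \<le> d" for i
    using good[OF that] by (intro nonneg) (simp add: feasible_def)
  have main: "(real p + 1 + 4 * real p / real i) * f (S i) \<ge> f OPT" if i: "i \<in> {1..d}" for i
  proof (cases "p = 0")
    case True
    obtain j where j: "i = Suc j" "Suc j \<le> d" using i by (cases i) auto
    obtain D where "0 \<le> D"
      "f OPT \<le> f (S i) + D + (1 + beta_seq p i) * (real p * f (S i) + (real p - 1) * D)"
      using bound[OF j(2)] j(1) by blast
    \<comment> \<open>For \<open>p = 0\<close> the bound collapses to
      \<open>f (S i) - beta_seq p i * D\<close>.\<close>
    moreover have "0 \<le> beta_seq p i * D" using \<open>0 \<le> D\<close> beta_seq_nonneg by simp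
    ultimately show ?thesis using True by (simp add: algebra_simps)
  next
    case False
    then have p: "1 \<le> p" by simp
    have "f OPT \<le> gamma_seq p (Suc j) * f (S (Suc j))" if "Suc j \<le> d" for j
      using that
    proof (induction j)
      case 0
      obtain D where D: "0 \<le> D" "beta_seq p (Suc 0) * D \<le> f (S (Suc 0)) - f (S 0)"
        "f OPT \<le> f (S (Suc 0)) + D + (1 + beta_seq p (Suc 0)) *
          (real p * f (S (Suc 0)) + (real p - 1) * D)"
        using bound[OF 0] by blast
      have "beta_seq p (Suc 0) = 1" by (simp add: beta_seq_def)
      then show ?case
        using first_pass_ratio[of "real p" "f (S 0)" D "f (S (Suc 0))" "f OPT"] D p f0[of 0] by simp
    next
      case (Suc j)
      obtain D where D: "0 \<le> D" "beta_seq p (Suc (Suc j)) * D \<le> f (S (Suc (Suc j))) - f (S (Suc j))"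
        "f OPT \<le> f (S (Suc (Suc j))) + D + (1 + beta_seq p (Suc (Suc j))) *
          (real p * f (S (Suc (Suc j))) + (real p - 1) * D)"
        using bound[OF Suc.prems] by blast
      have "f OPT \<le> gamma_seq p (Suc j) * f (S (Suc j))" using Suc by simp
      moreover have "beta_seq p (Suc (Suc j)) =
          (gamma_seq p (Suc j) - 1 - real p) / (gamma_seq p (Suc j) - 1 + real p)"
        by (simp add: beta_seq_def)
      ultimately show ?case
        using later_pass_ratio[OF _ _ _ D(2) _ D(3)] gamma_seq_bounds[OF p, of j] p by simp
    qed
    then have "f OPT \<le> gamma_seq p i * f (S i)" using i by (cases i) auto
    also have "\<dots> \<le> (real p + 1 + 4 * real p / real i) * f (S i)"
      using gamma_seq_le[OF p] i f0 by (intro mult_right_mono) auto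
    finally show ?thesis .
  qed
  moreover have "(real p + 1 + \<epsilon>) * f (S i) \<ge> f OPT"
    if \<epsilon>: "0 < \<epsilon>" and i: "i \<in> {1..d}" and large: "real i \<ge> 4 * real p / \<epsilon>" for \<epsilon> :: real and i
  proof -
    have "4 * real p / real i \<le> \<epsilon>" using large \<epsilon> i by (simp add: field_simps)
    then have "(real p + 1 + 4 * real p / real i) * f (S i) \<le> (real p + 1 + \<epsilon>) * f (S i)"
      using f0[of i] i by (intro mult_right_mono) auto
    then show ?thesis using main[OF i] by linarith
  qed
  ultimately show ?thesis by blast
qed

end
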